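(* Let $\mathbb{K}\in\{\mathbb{R},\mathbb{C}\}$. Let $\mathbb{P}_0$, $(p_n)_{n\in\mathbb{P}_0}$, $(Z_n,h_n,1_n)_{n\in\mathbb{P}_0}$, $(\gamma_m)_{m\in\mathbb{N}_0}$, $\omega X_0$, $X=\omega X_0+\mathcal{N}\cup\{\infty\}$, and the codimension $1$ linear isometry $T=T[a,\phi,\Delta]:C(X)\to C(X)$ be as described in the context. Then $T$ is an isometric shift of type $\mathrm{I}_0$. Also, $T$ is $\infty$-generated if $\mathbb{P}_0=\mathbb{N}$, and it is $P_0$-generated if $\mathbb{P}_0=\{1,2,\dots,P_0\}$.
   Context: All topological spaces are Tychonoff; "$+$" denotes topological sum; $\mathbb{N}=\{1,2,\dots\}$. Index sets. $\mathbb{P}_0\subset\mathbb{N}$ is an initial subset, i.e. $\mathbb{P}_0=\mathbb{N}$ or $\mathbb{P}_0=\{1,\dots,P_0\}$ for some $P_0\in\mathbb{N}$. $(p_n)_{n\in\mathbb{P}_0}$ is a $\mathbb{P}_0$-compatible sequence of natural numbers: if $\mathbb{P}_0=\{1\}$ then $p_1>1$; if $\mathbb{P}_0\neq\{1\}$ then $p_{n+1}$ is an even multiple of $p_n$ (i.e. $p_{n+1}=2lp_n$ with $l\in\mathbb{N}$) whenever $n,n+1\in\mathbb{P}_0$. $\mathbb{N}_0:=\mathbb{N}$ if $\mathbb{P}_0=\mathbb{N}$, and $\mathbb{N}_0:=\{1,\dots,p_1+\cdots+p_{P_0}\}$ if $\mathbb{P}_0=\{1,\dots,P_0\}$. Partition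 $\mathbb{N}_0$ into consecutive blocks: $A_1:=\{1,\dots,p_1\}$ and $A_{n+1}:=\{p_1+\cdots+p_n+1,\dots,p_1+\cdots+p_{n+1}\}$; write $A_n=\{a^n_1,\dots,a^n_{p_n}\}$ in increasing order. Define $s_n:A_n\to A_n$ by $s_n(a^n_1):=a^n_{p_n}$ and $s_n(a^n_j):=a^n_{j-1}$ for $2\le j\le p_n$. The basic family. For each $n\in\mathbb{P}_0$, $Z_n$ is a topological space, $h_n$ is a homeomorphism of $Z_n$ onto itself, and $1_n\in Z_n$ is such that $\{h_n^k(1_n):k\in\mathbb{N}\}$ is dense in $Z_n$. The family $(Z_n,h_n,1_n)_{n\in\mathbb{P}_0}$ is assumed to be $\mathbb{L}_0$-transitive for $\mathbb{L}_0:=\{2p_n:n\in\mathbb{P}_0\}$, meaning: for every $k\in\mathbb{L}_0$ and $i\in\mathbb{N}$, the point $(h_n^i(1_n))_{n\in\mathbb{P}_0}$ belongs to the closure in $\prod_{n\in\mathbb{P}_0}Z_n$ of $\{(h_n^{kj}(1_n))_{n\in\mathbb{P}_0}:j\in\mathbb{N}\}$. The spaces and maps. $X_n:=A_n\times Z_n$ ($A_n$ discrete), $\chi_n:X_n\to X_n$, $\chi_n(a^n_j,z):=(s_n(a^n_j),h_n^{-1}(z))$. $X_0$ is the topological sum of all $X_n$, $n\in\mathbb{P}_0$. $\phi:X_0\to X_0$ is the homeomorphism equal to $\chi_n$ on $X_n$. $a:X_0\to\mathbb{K}$ is $a(a^n_1,z)=-1$ for all $n\in\mathbb{P}_0$,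 $z\in Z_n$, and $a\equiv1$ on the rest of $X_0$. $\omega X_0$ is any compactification of $X_0$ such that $\phi$ extends to a homeomorphism of $\omega X_0$ onto itself and $a$ extends to a continuous function on $\omega X_0$ (extensions denoted by the same letters). $X:=\omega X_0+\mathcal{N}\cup\{\infty\}$, where $\mathcal{N}\cup\{\infty\}$ is the one-point compactification of the discrete set $\mathcal{N}=\{\mathbf{1},\mathbf{2},\dots\}$. Extend $a$ by $1$ on $(\mathcal{N}\cup\{\infty\})\setminus\{\mathbf{1}\}$, and extend $\phi$ to a homeomorphism $\phi:X\setminus\{\mathbf{1}\}\to X$ by $\phi(\mathbf{n+1})=\mathbf{n}$, $\phi(\infty)=\infty$. The coefficients. $(\gamma_m)_{m\in\mathbb{N}_0}\subset\mathbb{K}$ satisfies: at least two $\gamma_m$ are nonzero; $\sum_{m\in\mathbb{N}_0}|\gamma_m|\le1$; and for every $n\in\mathbb{P}_0$ the $p_n\times p_n$ matrix $$M_n^{\gamma}=\begin{pmatrix}\gamma_{a_1^n}&\gamma_{a_2^n}&\cdots&\gamma_{a_{p_n-1}^n}&\gamma_{a_{p_n}^n}\\-\gamma_{a_{p_n}^n}&\gamma_{a_1^n}&\cdots&\gamma_{a_{p_n-2}^n}&\gamma_{a_{p_n-1}^n}\\-\gamma_{a_{p_n-1}^n}&-\gamma_{a_{p_n}^n}&\cdots&\gamma_{a_{p_n-3}^n}&\gamma_{a_{p_n-2}^n}\\\vdots&\vdots&\ddots&\vdots&\vdots\\-\gamma_{a_2^n}&-\gamma_{a_3^n}&\cdots&-\gamma_{a_{p_n}^n}&\gamma_{a_1^n}\end{pmatrix}$$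 has nonzero determinant. The isometry. $C(X)$ is the Banach space of $\mathbb{K}$-valued continuous functions on $X$ with the supremum norm. Put $\Delta(f):=\sum_{n\in\mathbb{P}_0}\sum_{m\in A_n}\gamma_mf(m,1_n)$ for $f\in C(X)$. $T=T[a,\phi,\Delta]:C(X)\to C(X)$ is given by $(Tf)(x):=a(x)f(\phi(x))$ for $x\ne\mathbf{1}$ and $(Tf)(\mathbf{1}):=\Delta(f)$. Shifts. An isometric shift on a Banach space $E$ is a linear isometry $T:E\to E$ with $T(E)$ of codimension $1$ and $\bigcap_{n\ge1}T^n(E)=\{0\}$. An isometric shift $T$ on $C(X)$ is of type $\mathrm{I}$ if there are an isolated point $p\in X$, a homeomorphism $\phi$ from $X\setminus\{p\}$ onto $X$ and $a\in C(X\setminus\{p\})$, $|a|\equiv1$, such that $(Tf)(x)=a(x)f(\phi(x))$ for all $x\ne p$ and all $f$; of type $\mathrm{II}$ if there are a continuous surjection $\phi:X\to X$ and $a\in C(X)$, $|a|\equiv1$, with $(Tf)(x)=a(x)f(\phi(x))$ for all $x\in X$ and all $f$; and of type $\mathrm{I}_0$ if it is of type $\mathrm{I}$ and not of type $\mathrm{II}$. For $T=T[a,\phi,\Delta]$ an isometric shift and $n\in\mathbb{N}$, $T$ is $n$-generated if $n$ is the least number for which there are $x_1,\dots,x_n\in X\setminus\mathrm{cl}_X(\mathcal{N})$ such that $\{\phi^k(x_i):k\in\mathbb{Z},1\le i\le n\}$ is dense in $X\setminus\mathrm{cl}_X(\mathcal{N})$; $T$ is $\infty$-generated if it is not $n$-generated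 for any $n\in\mathbb{N}$. *)

theory Defs
  imports "HOL-Analysis.Analysis" "Jordan_Normal_Form.Determinant"
begin

section \<open>Isometric shifts on spaces of continuous functions\<close>

text \<open>Functions on a space \<open>X\<close> are extended by \<open>0\<close> outside \<^term>\<open>topspace X\<close>, so that each
  continuous function on \<open>X\<close> has exactly one representative and the vector space operations
  are the pointwise ones.\<close>

definition cspace :: "'x topology \<Rightarrow> ('x \<Rightarrow> 'k::real_normed_field) set" where
  "cspace X = {f. continuous_map X euclidean f \<and> (\<forall>x. x \<notin> topspace X \<longrightarrow> f x = 0)}"

definition sup_norm :: "'x topology \<Rightarrow> ('x \<Rightarrow> 'k::real_normed_field) \<Rightarrow> real" where
  "sup_norm X f = (SUP x\<in>topspace X. norm (f x))"

definition linear_isometry :: "'x topology \<Rightarrow> (('x \<Rightarrow> 'k::real_normed_field) \<Rightarrow> 'x \<Rightarrow> 'k) \<Rightarrow> bool" where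
  "linear_isometry X T \<longleftrightarrow>
     T ` cspace X \<subseteq> cspace X \<and>
     (\<forall>f\<in>cspace X. \<forall>g\<in>cspace X. T (\<lambda>x. f x + g x) = (\<lambda>x. T f x + T g x)) \<and>
     (\<forall>c. \<forall>f\<in>cspace X. T (\<lambda>x. c * f x) = (\<lambda>x. c * T f x)) \<and>
     (\<forall>f\<in>cspace X. sup_norm X (T f) = sup_norm X f)"

text \<open>For a linear subspace \<open>S\<close> of \<open>E\<close>: the quotient \<open>E / S\<close> is spanned by the class of a
  single \<open>u\<close>, and this class is nonzero. The scalars are those of \<open>'k\<close>.\<close>

definition codimension_one :: "('x \<Rightarrow> 'k::real_normed_field) set \<Rightarrow> ('x \<Rightarrow> 'k) set \<Rightarrow> bool" where
  "codimension_one S E \<longleftrightarrow>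
     S \<subseteq> E \<and> (\<exists>u\<in>E. u \<notin> S \<and> (\<forall>f\<in>E. \<exists>c. \<exists>g\<in>S. f = (\<lambda>x. c * u x + g x)))"

definition isometric_shift :: "'x topology \<Rightarrow> (('x \<Rightarrow> 'k::real_normed_field) \<Rightarrow> 'x \<Rightarrow> 'k) \<Rightarrow> bool" where
  "isometric_shift X T \<longleftrightarrow>
     linear_isometry X T \<and>
     codimension_one (T ` cspace X) (cspace X) \<and>
     (\<Inter>n\<in>{1..}. (T ^^ n) ` cspace X) = {\<lambda>x. 0}"

definition shift_type_I :: "'x topology \<Rightarrow> (('x \<Rightarrow> 'k::real_normed_field) \<Rightarrow> 'x \<Rightarrow> 'k) \<Rightarrow> bool" where
  "shift_type_I X T \<longleftrightarrow>
     isometric_shift X T \<and>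
     (\<exists>q\<in>topspace X. \<exists>\<phi> a. openin X {q} \<and>
        homeomorphic_map (subtopology X (topspace X - {q})) X \<phi> \<and>
        continuous_map (subtopology X (topspace X - {q})) euclidean a \<and>
        (\<forall>x\<in>topspace X - {q}. norm (a x) = 1) \<and>
        (\<forall>f\<in>cspace X. \<forall>x\<in>topspace X - {q}. T f x = a x * f (\<phi> x)))"

definition shift_type_II :: "'x topology \<Rightarrow> (('x \<Rightarrow> 'k::real_normed_field) \<Rightarrow> 'x \<Rightarrow> 'k) \<Rightarrow> bool" where
  "shift_type_II X T \<longleftrightarrow>
     isometric_shift X T \<and>
     (\<exists>\<phi> a. continuous_map X X \<phi> \<and> \<phi> ` topspace X = topspace X \<and>
        continuous_map X euclidean a \<and>
        (\<forall>x\<in>topspace X. norm (a x) = 1) \<and>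
        (\<forall>f\<in>cspace X. \<forall>x\<in>topspace X. T f x = a x * f (\<phi> x)))"

definition shift_type_I0 :: "'x topology \<Rightarrow> (('x \<Rightarrow> 'k::real_normed_field) \<Rightarrow> 'x \<Rightarrow> 'k) \<Rightarrow> bool" where
  "shift_type_I0 X T \<longleftrightarrow> shift_type_I X T \<and> \<not> shift_type_II X T"

text \<open>The operator \<open>T[a,\<phi>,\<Delta>]\<close> with distinguished isolated point \<open>q\<close>.\<close>

definition shift_op :: "'x topology \<Rightarrow> 'x \<Rightarrow> ('x \<Rightarrow> 'k) \<Rightarrow> ('x \<Rightarrow> 'x) \<Rightarrow> (('x \<Rightarrow> 'k) \<Rightarrow> 'k)
    \<Rightarrow> ('x \<Rightarrow> 'k::real_normed_field) \<Rightarrow> 'x \<Rightarrow> 'k" where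
  "shift_op X q a \<phi> \<Delta> f =
     (\<lambda>x. if x \<notin> topspace X then 0 else if x = q then \<Delta> f else a x * f (\<phi> x))"

text \<open>Whether \<open>T[a,\<phi>,\<Delta>]\<close> is \<open>n\<close>-generated depends only on \<open>X\<close>, on the isolated point \<open>q\<close>, on
  the bijection \<open>\<phi>\<close> from \<open>X - {q}\<close> onto \<open>X\<close> and on the set \<open>N\<close> of the points
  \<open>q, \<phi>\<^sup>-\<^sup>1 q, \<phi>\<^sup>-\<^sup>2 q, \<dots>\<close>. Negative powers of \<open>\<phi>\<close> are powers of its inverse.\<close>

definition orbit_Z :: "'x topology \<Rightarrow> 'x \<Rightarrow> ('x \<Rightarrow> 'x) \<Rightarrow> 'x \<Rightarrow> 'x set" where
  "orbit_Z X q \<phi> x =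
     {(\<phi> ^^ k) x | k. True} \<union> {(inv_into (topspace X - {q}) \<phi> ^^ k) x | k. True}"

definition generated_by :: "'x topology \<Rightarrow> 'x \<Rightarrow> 'x set \<Rightarrow> ('x \<Rightarrow> 'x) \<Rightarrow> nat \<Rightarrow> bool" where
  "generated_by X q N \<phi> n \<longleftrightarrow>
     (\<exists>x. (\<forall>i\<in>{1..n}. x i \<in> topspace X - X closure_of N) \<and>
        subtopology X (topspace X - X closure_of N) closure_of (\<Union>i\<in>{1..n}. orbit_Z X q \<phi> (x i))
          = topspace X - X closure_of N)"

definition n_generated :: "'x topology \<Rightarrow> 'x \<Rightarrow> 'x set \<Rightarrow> ('x \<Rightarrow> 'x) \<Rightarrow> nat \<Rightarrow> bool" where
  "n_generated X q N \<phi> n \<longleftrightarrow>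
     1 \<le> n \<and> generated_by X q N \<phi> n \<and> (\<forall>m. 1 \<le> m \<and> m < n \<longrightarrow> \<not> generated_by X q N \<phi> m)"

definition infinitely_generated :: "'x topology \<Rightarrow> 'x \<Rightarrow> 'x set \<Rightarrow> ('x \<Rightarrow> 'x) \<Rightarrow> bool" where
  "infinitely_generated X q N \<phi> \<longleftrightarrow> (\<forall>n\<ge>1. \<not> n_generated X q N \<phi> n)"


section \<open>Index sets and blocks\<close>

definition initial_index_set :: "nat set \<Rightarrow> bool" where
  "initial_index_set P \<longleftrightarrow> P = {1..} \<or> (\<exists>N\<ge>1. P = {1..N})"

definition compatible_sequence :: "nat set \<Rightarrow> (nat \<Rightarrow> nat) \<Rightarrow> bool" where
  "compatible_sequence P p \<longleftrightarrow>
     (\<forall>n\<in>P. 1 \<le> p n) \<and>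
     (if P = {1} then p 1 > 1
      else \<forall>n. n \<in> P \<and> n + 1 \<in> P \<longrightarrow> (\<exists>l\<ge>1. p (n + 1) = 2 * l * p n))"

definition coeff_index :: "nat set \<Rightarrow> (nat \<Rightarrow> nat) \<Rightarrow> nat set" where
  "coeff_index P p = (if P = {1..} then {1..} else {1..\<Sum>n\<in>P. p n})"

text \<open>\<open>block_elem p n j\<close> is the \<open>j\<close>-th element of the \<open>n\<close>-th block, for \<open>1 \<le> j \<le> p n\<close>.\<close>

definition block_elem :: "(nat \<Rightarrow> nat) \<Rightarrow> nat \<Rightarrow> nat \<Rightarrow> nat" where
  "block_elem p n j = (\<Sum>i\<in>{1..<n}. p i) + j"

definition block :: "(nat \<Rightarrow> nat) \<Rightarrow> nat \<Rightarrow> nat set" where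
  "block p n = block_elem p n ` {1..p n}"

definition block_shift :: "(nat \<Rightarrow> nat) \<Rightarrow> nat \<Rightarrow> nat \<Rightarrow> nat" where
  "block_shift p n m = (if m = block_elem p n 1 then block_elem p n (p n) else m - 1)"

text \<open>The rows and columns of \<^const>\<open>Matrix.mat\<close> are numbered from \<open>0\<close>.\<close>

definition coeff_matrix :: "(nat \<Rightarrow> nat) \<Rightarrow> (nat \<Rightarrow> 'k::real_normed_field) \<Rightarrow> nat \<Rightarrow> 'k Matrix.mat" where
  "coeff_matrix p \<gamma> n = Matrix.mat (p n) (p n)
     (\<lambda>(i, j). if i \<le> j then \<gamma> (block_elem p n (j - i + 1))
               else - \<gamma> (block_elem p n (p n - (i - j) + 1)))"

definition admissible_coeffs :: "nat set \<Rightarrow> (nat \<Rightarrow> nat) \<Rightarrow> (nat \<Rightarrow> 'k::real_normed_field) \<Rightarrow> bool" where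
  "admissible_coeffs P p \<gamma> \<longleftrightarrow>
     (\<exists>m\<in>coeff_index P p. \<exists>m'\<in>coeff_index P p. m \<noteq> m' \<and> \<gamma> m \<noteq> 0 \<and> \<gamma> m' \<noteq> 0) \<and>
     (\<lambda>m. norm (\<gamma> m)) summable_on coeff_index P p \<and>
     (\<Sum>\<^sub>\<infinity>m\<in>coeff_index P p. norm (\<gamma> m)) \<le> 1 \<and>
     (\<forall>n\<in>P. Determinant.det (coeff_matrix p \<gamma> n) \<noteq> 0)"


section \<open>The spaces and maps\<close>

definition tychonoff_space :: "'x topology \<Rightarrow> bool" where
  "tychonoff_space X \<longleftrightarrow> completely_regular_space X \<and> Hausdorff_space X"

text \<open>In the following, \<open>pt n\<close> stands for the point \<open>1\<^sub>n\<close> of \<open>Z n\<close>.\<close>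

definition basic_family :: "nat set \<Rightarrow> (nat \<Rightarrow> 'z topology) \<Rightarrow> (nat \<Rightarrow> 'z \<Rightarrow> 'z) \<Rightarrow> (nat \<Rightarrow> 'z) \<Rightarrow> bool" where
  "basic_family P Z h pt \<longleftrightarrow>
     (\<forall>n\<in>P. tychonoff_space (Z n) \<and>
        homeomorphic_map (Z n) (Z n) (h n) \<and>
        pt n \<in> topspace (Z n) \<and>
        Z n closure_of {(h n ^^ k) (pt n) | k. 1 \<le> k} = topspace (Z n))"

definition transitive_family ::
    "nat set \<Rightarrow> nat set \<Rightarrow> (nat \<Rightarrow> 'z topology) \<Rightarrow> (nat \<Rightarrow> 'z \<Rightarrow> 'z) \<Rightarrow> (nat \<Rightarrow> 'z) \<Rightarrow> bool" where
  "transitive_family L P Z h pt \<longleftrightarrow>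
     (\<forall>k\<in>L. \<forall>i\<ge>1. (\<lambda>n\<in>P. (h n ^^ i) (pt n)) \<in>
        product_topology Z P closure_of {(\<lambda>n\<in>P. (h n ^^ (k * j)) (pt n)) | j. 1 \<le> j})"

text \<open>A point of the topological sum of the \<open>A\<^sub>n \<times> Z\<^sub>n\<close> is a triple \<open>(n, m, z)\<close> with \<open>m \<in> A\<^sub>n\<close>
  and \<open>z \<in> Z\<^sub>n\<close>.\<close>

definition space_X0 :: "nat set \<Rightarrow> (nat \<Rightarrow> nat) \<Rightarrow> (nat \<Rightarrow> 'z topology) \<Rightarrow> (nat \<times> nat \<times> 'z) topology" where
  "space_X0 P p Z = sum_topology (\<lambda>n. prod_topology (discrete_topology (block p n)) (Z n)) P"

definition phi_X0 :: "(nat \<Rightarrow> nat) \<Rightarrow> (nat \<Rightarrow> 'z topology) \<Rightarrow> (nat \<Rightarrow> 'z \<Rightarrow> 'z)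
    \<Rightarrow> nat \<times> nat \<times> 'z \<Rightarrow> nat \<times> nat \<times> 'z" where
  "phi_X0 p Z h = (\<lambda>(n, m, z). (n, block_shift p n m, inv_into (topspace (Z n)) (h n) z))"

definition weight_X0 :: "(nat \<Rightarrow> nat) \<Rightarrow> nat \<times> nat \<times> 'z \<Rightarrow> 'k::real_normed_field" where
  "weight_X0 p = (\<lambda>(n, m, z). if m = block_elem p n 1 then - 1 else 1)"

definition compactification :: "'y topology \<Rightarrow> 'w topology \<Rightarrow> ('y \<Rightarrow> 'w) \<Rightarrow> bool" where
  "compactification Y W e \<longleftrightarrow>
     compact_space W \<and> Hausdorff_space W \<and> embedding_map Y W e \<and>
     W closure_of (e ` topspace Y) = topspace W"

definition phi_extension :: "nat set \<Rightarrow> (nat \<Rightarrow> nat) \<Rightarrow> (nat \<Rightarrow> 'z topology) \<Rightarrow> (nat \<Rightarrow> 'z \<Rightarrow> 'z)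
    \<Rightarrow> 'w topology \<Rightarrow> (nat \<times> nat \<times> 'z \<Rightarrow> 'w) \<Rightarrow> ('w \<Rightarrow> 'w) \<Rightarrow> bool" where
  "phi_extension P p Z h W e \<phi> \<longleftrightarrow>
     homeomorphic_map W W \<phi> \<and> (\<forall>y\<in>topspace (space_X0 P p Z). \<phi> (e y) = e (phi_X0 p Z h y))"

definition weight_extension :: "nat set \<Rightarrow> (nat \<Rightarrow> nat) \<Rightarrow> (nat \<Rightarrow> 'z topology)
    \<Rightarrow> 'w topology \<Rightarrow> (nat \<times> nat \<times> 'z \<Rightarrow> 'w) \<Rightarrow> ('w \<Rightarrow> 'k::real_normed_field) \<Rightarrow> bool" where
  "weight_extension P p Z W e a \<longleftrightarrow>
     continuous_map W euclidean a \<and> (\<forall>y\<in>topspace (space_X0 P p Z). a (e y) = weight_X0 p y)"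

text \<open>Binary topological sum of spaces over possibly different types.\<close>

definition plus_topology :: "'a topology \<Rightarrow> 'b topology \<Rightarrow> ('a + 'b) topology" where
  "plus_topology X Y = topology (\<lambda>U. openin X (Inl -` U) \<and> openin Y (Inr -` U))"

lemma openin_plus_topology:
  "openin (plus_topology X Y) U \<longleftrightarrow> openin X (Inl -` U) \<and> openin Y (Inr -` U)"
proof -
  have "istopology (\<lambda>U. openin X (Inl -` U) \<and> openin Y (Inr -` U))"
    unfolding istopology_def by (auto simp: vimage_Union)
  then show ?thesis
    by (simp add: plus_topology_def)
qed

lemma topspace_plus_topology: "topspace (plus_topology X Y) = topspace X <+> topspace Y"
proof
  show "topspace (plus_topology X Y) \<subseteq> topspace X <+> topspace Y"
  proof
    fix x assume "x \<in> topspace (plus_topology X Y)"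
    then obtain U where "openin X (Inl -` U)" "openin Y (Inr -` U)" "x \<in> U"
      by (auto simp: topspace_def openin_plus_topology)
    then show "x \<in> topspace X <+> topspace Y"
      by (cases x) (auto dest!: openin_subset)
  qed
  have "Inl -` (topspace X <+> topspace Y) = topspace X"
    "Inr -` (topspace X <+> topspace Y) = topspace Y" by auto
  then have "openin (plus_topology X Y) (topspace X <+> topspace Y)"
    by (simp add: openin_plus_topology)
  then show "topspace X <+> topspace Y \<subseteq> topspace (plus_topology X Y)"
    by (rule openin_subset)
qed

text \<open>\<open>Inr (Some n)\<close> with \<open>n \<ge> 1\<close> is the point \<open>n\<close> of the discrete set \<open>N = {1,2,\<dots>}\<close>, and
  \<open>Inr None\<close> is the point \<open>\<infinity>\<close>.\<close>

definition space_X :: "'w topology \<Rightarrow> ('w + nat option) topology" where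
  "space_X W = plus_topology W (Alexandroff_compactification (discrete_topology {1..}))"

definition nat_points :: "('w + nat option) set" where
  "nat_points = (\<lambda>n. Inr (Some n)) ` {1..}"

definition point_one :: "'w + nat option" where
  "point_one = Inr (Some 1)"

fun phi_X :: "('w \<Rightarrow> 'w) \<Rightarrow> 'w + nat option \<Rightarrow> 'w + nat option" where
  "phi_X \<phi> (Inl w) = Inl (\<phi> w)"
| "phi_X \<phi> (Inr (Some n)) = Inr (Some (n - 1))"
| "phi_X \<phi> (Inr None) = Inr None"

fun weight_X :: "('w \<Rightarrow> 'k::real_normed_field) \<Rightarrow> 'w + nat option \<Rightarrow> 'k" where
  "weight_X a (Inl w) = a w"
| "weight_X a (Inr x) = 1"

definition delta_X :: "nat set \<Rightarrow> (nat \<Rightarrow> nat) \<Rightarrow> (nat \<Rightarrow> 'z) \<Rightarrow> (nat \<times> nat \<times> 'z \<Rightarrow> 'w)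
    \<Rightarrow> (nat \<Rightarrow> 'k::real_normed_field) \<Rightarrow> ('w + nat option \<Rightarrow> 'k) \<Rightarrow> 'k" where
  "delta_X P p pt e \<gamma> f = (\<Sum>\<^sub>\<infinity>n\<in>P. \<Sum>m\<in>block p n. \<gamma> m * f (Inl (e (n, m, pt n))))"

definition shift_T :: "nat set \<Rightarrow> (nat \<Rightarrow> nat) \<Rightarrow> (nat \<Rightarrow> 'z) \<Rightarrow> 'w topology
    \<Rightarrow> (nat \<times> nat \<times> 'z \<Rightarrow> 'w) \<Rightarrow> ('w \<Rightarrow> 'w) \<Rightarrow> ('w \<Rightarrow> 'k) \<Rightarrow> (nat \<Rightarrow> 'k::real_normed_field)
    \<Rightarrow> ('w + nat option \<Rightarrow> 'k) \<Rightarrow> 'w + nat option \<Rightarrow> 'k" where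
  "shift_T P p pt W e \<phi> a \<gamma> =
     shift_op (space_X W) point_one (weight_X a) (phi_X \<phi>) (delta_X P p pt e \<gamma>)"

end

(* If f lies in the range of every T^k, then f(k) = Delta(T^{-k} f) for every point k of N, so these
   numbers converge to f(infinity). Extending f antiperiodically along each block A_n makes T a
   translation: f(k) is a sum over n of terms D_n(k, h_n^k 1_n), where D_n(k, z) is continuous in z and
   changes sign under k -> k + p_n. A finite partial sum has period 2 p_N in k, so transitivity of the
   family frees the point from the time: D_1(k, .) + ... + D_N(k, .) is almost constant along the
   orbits. Since p_{n+1} is an even multiple of p_n, averaging over k isolates each D_m, which
   therefore vanishes, and the invertibility of M_m gives f = 0 on A_m x Z_m.
   T is not of type II because Delta charges at least two points. The closures in W of the parts of
   X_0 over disjoint sets of indices are invariant and miss each other's part of X_0, so that fewer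
   than |P| orbits cannot be dense. *)

theory Submission
  imports Defs
begin

section \<open>The space \<open>X\<close> and the map \<open>\<phi>\<close>\<close>

no_notation eq_closure_of (\<open>closure'_of\<index>\<close>)

text \<open>The obstacle is that the time k enters D_n twice, as an index in the block and as an
  iterate of h_n, and that the limit f(infinity) is unknown. Transitivity is used in the product and
  with the exponent 2 p_N because the summands with n up to N have to be decoupled simultaneously,
  and 2 p_N is a common period of their indices: the index can be held fixed while the iterate runs
  through all later times. The tail beyond N costs at most the norm of f times the mass of the
  coefficients on the later blocks, whatever k is. The unknown limit cancels when two averages at
  distance p_m are subtracted. The signs below the diagonal of M_n are those of the antiperiodic
  extension: the rows of M_n are the functionals D_n(k, z) for k = 0, ..., p_n - 1, expressed in the
  values of f on A_n x {z}.\<close>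

lemma continuous_map_plus_topology:
  "continuous_map (plus_topology X Y) Z f \<longleftrightarrow>
     continuous_map X Z (f \<circ> Inl) \<and> continuous_map Y Z (f \<circ> Inr)"
proof -
  have "Inl -` {x \<in> topspace X <+> topspace Y. f x \<in> U} = {x \<in> topspace X. (f \<circ> Inl) x \<in> U}"
    "Inr -` {x \<in> topspace X <+> topspace Y. f x \<in> U} = {x \<in> topspace Y. (f \<circ> Inr) x \<in> U}" for U
    by auto
  then show ?thesis
    by (auto simp: continuous_map_def topspace_plus_topology openin_plus_topology Pi_iff)
qed

lemma closedin_plus_topology_Inl:
  assumes "closedin X C"
  shows "closedin (plus_topology X Y) (Inl ` C)"
proof -
  have "Inl -` (topspace X <+> topspace Y - Inl ` C) = topspace X - C"
    "Inr -` (topspace X <+> topspace Y - Inl ` C) = topspace Y" by auto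
  moreover have "C \<subseteq> topspace X"
    using assms closedin_subset by blast
  ultimately show ?thesis
    using assms
    by (auto simp: closedin_def openin_plus_topology topspace_plus_topology)
qed

lemma closure_of_plus_topology_Inl:
  "plus_topology X Y closure_of (Inl ` S) = Inl ` (X closure_of S)"
proof -
  have cm: "continuous_map X (plus_topology X Y) Inl"
    using continuous_map_plus_topology[of X Y "plus_topology X Y" id] by simp
  have "plus_topology X Y closure_of (Inl ` S) = plus_topology X Y closure_of (Inl ` (topspace X \<inter> S))"
    by (subst closure_of_restrict) (auto simp: topspace_plus_topology intro!: arg_cong[of _ _ "\<lambda>S. _ closure_of S"])
  also have "\<dots> \<subseteq> Inl ` (X closure_of S)"
    by (rule closure_of_minimal)
      (auto simp: closedin_plus_topology_Inl closure_of_subset_Int intro: subsetD[OF closure_of_subset_Int])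
  finally show ?thesis
    using continuous_map_image_closure_subset[OF cm, of S] by blast
qed

text \<open>Compact subsets of a discrete space are the finite ones, so the neighbourhoods of
  \<open>None\<close> are the cofinite sets.\<close>

lemma openin_Alexandroff_compactification_discrete:
  "openin (Alexandroff_compactification (discrete_topology A)) U \<longleftrightarrow>
     U \<subseteq> insert None (Some ` A) \<and> (None \<in> U \<longrightarrow> finite {n \<in> A. Some n \<notin> U})" (is "?L \<longleftrightarrow> ?R")
proof
  assume ?L
  then consider V where "V \<subseteq> A" "U = Some ` V"
    | C where "finite C" "C \<subseteq> A" "U = insert None (Some ` (A - C))"
    by (auto simp: openin_Alexandroff_compactification compactin_discrete_topology)
  then show ?R
  proof cases
    case 1
    then show ?thesis by auto
  next
    case 2
    moreover from 2 have "{n \<in> A. Some n \<notin> U} \<subseteq> C" by auto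
    ultimately show ?thesis by (auto intro: finite_subset)
  qed
next
  assume R: ?R
  show ?L
  proof (cases "None \<in> U")
    case True
    have "U = insert None (Some ` (A - {n \<in> A. Some n \<notin> U}))"
      using R True by auto
    moreover have "compactin (discrete_topology A) {n \<in> A. Some n \<notin> U}"
      using R True by (auto simp: compactin_discrete_topology)
    moreover have "closedin (discrete_topology A) {n \<in> A. Some n \<notin> U}" by auto
    ultimately show ?thesis
      unfolding openin_Alexandroff_compactification by (metis (no_types, lifting) topspace_discrete_topology)
  next
    case False
    then have "U = Some ` (Some -` U)" "Some -` U \<subseteq> A" using R
      by (auto elim!: option.exhaust simp: image_iff)
    then show ?thesis
      unfolding openin_Alexandroff_compactification by (metis openin_discrete_topology)
  qed
qed

lemma topspace_space_X: "topspace (space_X W) = Inl ` topspace W \<union> insert (Inr None) nat_points"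
  by (auto simp: space_X_def topspace_plus_topology nat_points_def)

lemma in_topspace_space_X [simp]:
  "Inl w \<in> topspace (space_X W) \<longleftrightarrow> w \<in> topspace W"
  "Inr (Some n) \<in> topspace (space_X W) \<longleftrightarrow> 1 \<le> n"
  "Inr None \<in> topspace (space_X W)"
  by (auto simp: topspace_space_X nat_points_def)

lemma openin_space_X:
  "openin (space_X W) U \<longleftrightarrow>
     openin W (Inl -` U) \<and> U \<subseteq> topspace (space_X W) \<and>
     (Inr None \<in> U \<longrightarrow> finite {n. 1 \<le> n \<and> Inr (Some n) \<notin> U})"
proof
  assume L: "openin (space_X W) U"
  then have "U \<subseteq> topspace (space_X W)" by (rule openin_subset)
  then show "openin W (Inl -` U) \<and> U \<subseteq> topspace (space_X W) \<and>
     (Inr None \<in> U \<longrightarrow> finite {n. 1 \<le> n \<and> Inr (Some n) \<notin> U})"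
    using L by (auto simp: space_X_def openin_plus_topology openin_Alexandroff_compactification_discrete)
next
  assume "openin W (Inl -` U) \<and> U \<subseteq> topspace (space_X W) \<and>
     (Inr None \<in> U \<longrightarrow> finite {n. 1 \<le> n \<and> Inr (Some n) \<notin> U})"
  then show "openin (space_X W) U"
    by (auto simp: space_X_def openin_plus_topology openin_Alexandroff_compactification_discrete
        topspace_plus_topology)
qed

text \<open>The point 1 is a case of its own because it lies outside the domain of the
  homeomorphism; the other points of N appear as successors, so that the index shift of
  \<open>phi_X\<close> computes.\<close>

lemma topspace_space_X_cases [consumes 1, case_names Inl one Suc infinity]:
  assumes "x \<in> topspace (space_X W)"
  obtains w where "x = Inl w" "w \<in> topspace W" | "x = point_one"
    | n where "1 \<le> n" "x = Inr (Some (Suc n))" | "x = Inr None"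
proof (cases x)
  case (Inl w)
  then show ?thesis using assms that by auto
next
  case (Inr y)
  show ?thesis
  proof (cases y)
    case None
    then show ?thesis using Inr that by auto
  next
    case (Some n)
    then have "1 \<le> n" using assms Inr by auto
    show ?thesis
    proof (cases "n = 1")
      case True
      then show ?thesis using Inr Some that by (auto simp: point_one_def)
    next
      case False
      then have "n = Suc (n - 1)" "1 \<le> n - 1" using \<open>1 \<le> n\<close> by auto
      then show ?thesis using Inr Some that by metis
    qed
  qed
qed

lemma Inl_neq_point_one [simp]: "Inl w \<noteq> point_one"
  and infinity_neq_point_one [simp]: "Inr None \<noteq> point_one"
  and point_one_in_space_X [simp]: "point_one \<in> topspace (space_X W)"
  by (auto simp: point_one_def)

text \<open>On the second summand, continuity is convergence of the values on N to the value at
  infinity; limits along N are later read off from the last conjunct.\<close>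

lemma continuous_map_space_X:
  "continuous_map (space_X W) Y f \<longleftrightarrow>
     continuous_map W Y (\<lambda>w. f (Inl w)) \<and> f ` topspace (space_X W) \<subseteq> topspace Y \<and>
     (\<forall>U. openin Y U \<and> f (Inr None) \<in> U \<longrightarrow> finite {n. 1 \<le> n \<and> f (Inr (Some n)) \<notin> U})"
  (is "?L \<longleftrightarrow> ?R")
proof -
  have *: "Inl -` {x \<in> topspace (space_X W). f x \<in> U} = {w \<in> topspace W. f (Inl w) \<in> U}" for U
    by auto
  have **: "{n. 1 \<le> n \<and> Inr (Some n) \<notin> {x \<in> topspace (space_X W). f x \<in> U}}
    = {n. 1 \<le> n \<and> f (Inr (Some n)) \<notin> U}" for U
    by auto
  have op: "openin (space_X W) {x \<in> topspace (space_X W). f x \<in> U} \<longleftrightarrow>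
     openin W {w \<in> topspace W. f (Inl w) \<in> U} \<and>
     (f (Inr None) \<in> U \<longrightarrow> finite {n. 1 \<le> n \<and> f (Inr (Some n)) \<notin> U})" for U
    unfolding openin_space_X * ** by auto
  have into: "f \<in> topspace (space_X W) \<rightarrow> topspace Y \<longleftrightarrow> f ` topspace (space_X W) \<subseteq> topspace Y"
    by (simp only: image_subset_iff_funcset)
  have "(\<lambda>w. f (Inl w)) \<in> topspace W \<rightarrow> topspace Y" if "f ` topspace (space_X W) \<subseteq> topspace Y"
    using that by (simp add: image_subset_iff Pi_iff)
  then show ?thesis
    unfolding continuous_map_def op into by blast
qed

lemma openin_point_one: "openin (space_X W) {point_one}"
  by (auto simp: openin_space_X vimage_def)

lemma openin_Diff_point_one: "openin (space_X W) (topspace (space_X W) - {point_one})"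
proof -
  have "Inl -` (topspace (space_X W) - {point_one}) = topspace W" by auto
  moreover have "{n. 1 \<le> n \<and> Inr (Some n) \<notin> topspace (space_X W) - {point_one}} \<subseteq> {1}"
    by (auto simp: point_one_def)
  ultimately show ?thesis
    unfolding openin_space_X by (auto intro: finite_subset)
qed

text \<open>Since the point 1 is isolated, the value there is unconstrained. This lets T prescribe
  \<Delta> f at this point without spoiling continuity.\<close>

lemma continuous_map_space_X_Diff_point_one:
  assumes f: "continuous_map (subtopology (space_X W) (topspace (space_X W) - {point_one})) Y f"
    and "f point_one \<in> topspace Y"
  shows "continuous_map (space_X W) Y f"
  unfolding continuous_map_def
proof (intro conjI allI impI)
  let ?X' = "topspace (space_X W) - {point_one}"
  show "f \<in> topspace (space_X W) \<rightarrow> topspace Y"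
    using assms by (auto simp: continuous_map_def Pi_iff)
  fix U assume "openin Y U"
  then have "openin (space_X W) {x \<in> ?X'. f x \<in> U}"
    using f openin_Diff_point_one[of W]
    by (auto simp: continuous_map_def openin_open_subtopology Int_absorb1)
  then have "openin (space_X W) ({x \<in> ?X'. f x \<in> U} \<union> (if f point_one \<in> U then {point_one} else {}))"
    by (intro openin_Un) (simp_all add: openin_point_one)
  moreover have "{x \<in> topspace (space_X W). f x \<in> U}
      = {x \<in> ?X'. f x \<in> U} \<union> (if f point_one \<in> U then {point_one} else {})"
    using point_one_in_space_X by auto
  ultimately show "openin (space_X W) {x \<in> topspace (space_X W). f x \<in> U}"
    by (simp only:)
qed

lemma closure_of_nat_points: "space_X W closure_of nat_points = insert (Inr None) nat_points"
proof
  have "topspace (space_X W) - insert (Inr None) nat_points = Inl ` topspace W"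
    by (auto simp: topspace_space_X nat_points_def)
  moreover have "openin (space_X W) (Inl ` topspace W)"
    by (auto simp: openin_space_X inj_vimage_image_eq)
  ultimately have "closedin (space_X W) (insert (Inr None) nat_points)"
    by (auto simp: closedin_def topspace_space_X)
  then show "space_X W closure_of nat_points \<subseteq> insert (Inr None) nat_points"
    by (intro closure_of_minimal) auto
  have "\<exists>y\<in>nat_points. y \<in> T" if T: "openin (space_X W) T" "Inr None \<in> T" for T
  proof -
    have "finite {n. 1 \<le> n \<and> Inr (Some n) \<notin> T}" using T by (auto simp: openin_space_X)
    moreover have "infinite {1::nat..}" by (simp add: infinite_Ici)
    ultimately have "infinite ({1..} - {n. 1 \<le> n \<and> Inr (Some n) \<notin> T})" by simp
    then have "{1..} - {n. 1 \<le> n \<and> Inr (Some n) \<notin> T} \<noteq> {}" by (rule infinite_imp_nonempty)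
    then obtain n where "n \<in> {1..} - {n. 1 \<le> n \<and> Inr (Some n) \<notin> T}" by blast
    then have "Inr (Some n) \<in> T" "1 \<le> n" by auto
    then show ?thesis by (auto simp: nat_points_def)
  qed
  then show "insert (Inr None) nat_points \<subseteq> space_X W closure_of nat_points"
    by (auto simp: in_closure_of) (auto simp: topspace_space_X)
qed

text \<open>Only N and its limit point are removed, so the number of generators is a matter of the
  orbits in W alone.\<close>

lemma space_X_minus_closure_of_nat_points:
  "topspace (space_X W) - space_X W closure_of nat_points = Inl ` topspace W"
  unfolding closure_of_nat_points by (auto simp: topspace_space_X nat_points_def)

text \<open>The inverse of \<open>phi_X \<phi>\<close> when \<open>\<psi>\<close> inverts
  \<open>\<phi>\<close>. On the space its values avoid \<open>point_one\<close>.\<close>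

fun psi_X :: "('w \<Rightarrow> 'w) \<Rightarrow> 'w + nat option \<Rightarrow> 'w + nat option" where
  "psi_X \<psi> (Inl w) = Inl (\<psi> w)"
| "psi_X \<psi> (Inr (Some n)) = Inr (Some (Suc n))"
| "psi_X \<psi> (Inr None) = Inr None"

lemma continuous_map_psi_X:
  assumes "continuous_map W W \<psi>"
  shows "continuous_map (space_X W) (space_X W) (psi_X \<psi>)"
  unfolding continuous_map_space_X
proof (intro conjI allI impI)
  have "continuous_map W (space_X W) Inl"
    using continuous_map_space_X[of W "space_X W" id] by simp
  then show "continuous_map W (space_X W) (\<lambda>w. psi_X \<psi> (Inl w))"
    using continuous_map_compose[OF assms] by (force simp: o_def)
  show "psi_X \<psi> ` topspace (space_X W) \<subseteq> topspace (space_X W)"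
  proof
    fix y assume "y \<in> psi_X \<psi> ` topspace (space_X W)"
    then obtain x where "x \<in> topspace (space_X W)" "y = psi_X \<psi> x" by auto
    then show "y \<in> topspace (space_X W)"
      using continuous_map_funspace[OF assms] by (cases rule: topspace_space_X_cases) (auto simp: point_one_def)
  qed
  fix U assume U: "openin (space_X W) U \<and> psi_X \<psi> (Inr None) \<in> U"
  have "finite {n. 1 \<le> n \<and> Inr (Some n) \<notin> U}" using U by (auto simp: openin_space_X)
  then have "finite (Suc -` {n. 1 \<le> n \<and> Inr (Some n) \<notin> U})"
    by (rule finite_vimageI) auto
  then show "finite {n. 1 \<le> n \<and> psi_X \<psi> (Inr (Some n)) \<notin> U}"
    by (rule rev_finite_subset) auto
qed

lemma continuous_map_phi_X:
  assumes "continuous_map W W \<phi>"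
  shows "continuous_map (subtopology (space_X W) (topspace (space_X W) - {point_one})) (space_X W) (phi_X \<phi>)"
proof -
  let ?X = "space_X W"
  have into: "phi_X \<phi> x \<in> topspace ?X" if "x \<in> topspace ?X - {point_one}" for x
  proof -
    have "x \<in> topspace ?X" using that by auto
    then show ?thesis
      using continuous_map_funspace[OF assms] that by (cases rule: topspace_space_X_cases) auto
  qed
  have "openin ?X {x \<in> topspace ?X - {point_one}. phi_X \<phi> x \<in> U}" if U: "openin ?X U" for U
  proof -
    have "Inl -` {x \<in> topspace ?X - {point_one}. phi_X \<phi> x \<in> U} = {w \<in> topspace W. \<phi> w \<in> Inl -` U}"
      by auto
    moreover have "openin W (Inl -` U)" using U by (simp add: openin_space_X)
    ultimately have 1: "openin W (Inl -` {x \<in> topspace ?X - {point_one}. phi_X \<phi> x \<in> U})"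
      using openin_continuous_map_preimage[OF assms, of "Inl -` U"] by simp
    have "finite {n. 1 \<le> n \<and> Inr (Some n) \<notin> {x \<in> topspace ?X - {point_one}. phi_X \<phi> x \<in> U}}" if "Inr None \<in> U"
    proof -
      have "finite {n. 1 \<le> n \<and> Inr (Some n) \<notin> U}" using U that by (simp add: openin_space_X)
      \<comment> \<open>A point n > 1 is mapped outside U exactly when its predecessor lies outside
        U, hence the image under \<open>Suc\<close>; the point 1 is added because it is not in the
        domain.\<close>
      then have "finite (insert 1 (Suc ` {n. 1 \<le> n \<and> Inr (Some n) \<notin> U}))" by simp
      moreover have "n \<in> insert 1 (Suc ` {n. 1 \<le> n \<and> Inr (Some n) \<notin> U})"
        if n: "1 \<le> n" "Inr (Some n) \<notin> {x \<in> topspace ?X - {point_one}. phi_X \<phi> x \<in> U}" for n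
      proof (cases "n = 1")
        case False
        then have "n - 1 \<in> {n. 1 \<le> n \<and> Inr (Some n) \<notin> U}" "n = Suc (n - 1)"
          using n by (auto simp: point_one_def)
        from this(2,1) have "n \<in> Suc ` {n. 1 \<le> n \<and> Inr (Some n) \<notin> U}" by (rule image_eqI)
        then show ?thesis by (rule insertI2)
      qed auto
      ultimately show ?thesis by (metis (no_types, lifting) finite_subset mem_Collect_eq subsetI)
    qed
    then show ?thesis
      unfolding openin_space_X[of W "{x \<in> topspace ?X - {point_one}. phi_X \<phi> x \<in> U}"]
      using 1 by auto
  qed
  then show ?thesis
    using into openin_Diff_point_one[of W] unfolding continuous_map_def
    by (auto simp: openin_open_subtopology Int_absorb1 Collect_conj_eq Pi_iff)
qed

lemma homeomorphic_maps_phi_X: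
  assumes "homeomorphic_maps W W \<phi> \<psi>"
  shows "homeomorphic_maps (subtopology (space_X W) (topspace (space_X W) - {point_one})) (space_X W)
    (phi_X \<phi>) (psi_X \<psi>)"
proof -
  let ?X = "space_X W"
  have c: "continuous_map W W \<phi>" "continuous_map W W \<psi>"
    and inv: "\<And>w. w \<in> topspace W \<Longrightarrow> \<psi> (\<phi> w) = w" "\<And>w. w \<in> topspace W \<Longrightarrow> \<phi> (\<psi> w) = w"
    using assms by (auto simp: homeomorphic_maps_def)
  have "psi_X \<psi> x \<noteq> point_one" if "x \<in> topspace ?X" for x
    using that by (cases rule: topspace_space_X_cases) (auto simp: point_one_def)
  then have "continuous_map ?X (subtopology ?X (topspace ?X - {point_one})) (psi_X \<psi>)"
    using continuous_map_psi_X[OF c(2)]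
    by (auto simp: continuous_map_in_subtopology dest: continuous_map_image_subset_topspace)
  moreover have "psi_X \<psi> (phi_X \<phi> x) = x" if "x \<in> topspace ?X" "x \<noteq> point_one" for x
    using that by (cases rule: topspace_space_X_cases) (auto simp: inv)
  moreover have "phi_X \<phi> (psi_X \<psi> x) = x" if "x \<in> topspace ?X" for x
    using that by (cases rule: topspace_space_X_cases) (auto simp: inv point_one_def)
  ultimately show ?thesis
    using continuous_map_phi_X[OF c(1)] by (auto simp: homeomorphic_maps_def)
qed

section \<open>Operations on continuous functions and their boundedness\<close>

lemma continuous_map_inverse_field [continuous_intros]:
  fixes f :: "'a \<Rightarrow> 'k::real_normed_div_algebra"
  shows "continuous_map X euclidean f \<Longrightarrow> (\<And>x. x \<in> topspace X \<Longrightarrow> f x \<noteq> 0)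
    \<Longrightarrow> continuous_map X euclidean (\<lambda>x. inverse (f x))"
  by (simp add: continuous_map_atin tendsto_inverse)

lemma continuous_map_mult_field [continuous_intros]:
  fixes f :: "'a \<Rightarrow> 'k::real_normed_algebra"
  shows "continuous_map X euclidean f \<Longrightarrow> continuous_map X euclidean g
    \<Longrightarrow> continuous_map X euclidean (\<lambda>x. f x * g x)"
  by (simp add: continuous_map_atin tendsto_mult)

text \<open>Both summands of X are compact. The bound covers every x of the type, as functions in
  \<open>cspace\<close> vanish off the space, so the later estimates of series carry no membership
  conditions.\<close>

lemma cspace_bounded:
  assumes W: "compact_space W" and f: "f \<in> cspace (space_X W)"
  shows "\<exists>B. \<forall>x. norm (f x) \<le> B"
proof -
  have f0: "f x = 0" if "x \<notin> topspace (space_X W)" for x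
    using f that by (simp add: cspace_def)
  have "continuous_map (space_X W) euclidean f" using f by (simp add: cspace_def)
  then have c: "continuous_map W euclidean (f \<circ> Inl)"
    "continuous_map (Alexandroff_compactification (discrete_topology {1..})) euclidean (f \<circ> Inr)"
    by (auto simp: space_X_def continuous_map_plus_topology)
  have "compact ((f \<circ> Inl) ` topspace W)"
    using image_compactin[OF _ c(1)] W by (simp add: compact_space_def)
  moreover have "compact ((f \<circ> Inr) ` topspace (Alexandroff_compactification (discrete_topology {1::nat..})))"
    using image_compactin[OF compact_space_Alexandroff_compactification[unfolded compact_space_def] c(2)]
    by (simp only: compactin_euclidean_iff)
  ultimately have "bounded ((f \<circ> Inl) ` topspace W \<union>
      (f \<circ> Inr) ` topspace (Alexandroff_compactification (discrete_topology {1::nat..})))"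
    by (intro bounded_Un[THEN iffD2] conjI compact_imp_bounded)
  then obtain B where B: "B > 0" "\<And>y. y \<in> ((f \<circ> Inl) ` topspace W \<union>
      (f \<circ> Inr) ` topspace (Alexandroff_compactification (discrete_topology {1::nat..}))) \<Longrightarrow> norm y \<le> B"
    unfolding bounded_pos by blast
  have "norm (f x) \<le> B" for x
  proof (cases "x \<in> topspace (space_X W)")
    case True
    then show ?thesis
    proof (cases rule: topspace_space_X_cases)
      case (Inl w)
      then show ?thesis by (auto intro!: B(2))
    qed (auto intro!: B(2) image_eqI simp: point_one_def)
  qed (use B f0 in auto)
  then show ?thesis by blast
qed

section \<open>Antiperiodic sequences and the coefficient matrix\<close>

lemma sum_lessThan_add:
  fixes q :: "nat \<Rightarrow> 'a::comm_monoid_add"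
  shows "(\<Sum>t<m + n. q t) = (\<Sum>t<m. q t) + (\<Sum>t<n. q (m + t))"
  by (induction n) (simp_all add: add.assoc)

text \<open>Consecutive stretches of length l cancel in pairs, and the range of summation consists
  of c such pairs.\<close>

lemma sum_antiperiodic:
  fixes q :: "nat \<Rightarrow> 'a::ab_group_add"
  assumes "\<And>t. q (t + l) = - q t"
  shows "(\<Sum>t<2 * l * c. q t) = 0"
proof (induction c)
  case (Suc c)
  have "2 * l * Suc c = 2 * l * c + (l + l)" by simp
  then have "(\<Sum>t<2 * l * Suc c. q t) = (\<Sum>t<l. q (2 * l * c + t)) + (\<Sum>t<l. q (2 * l * c + t + l))"
    using Suc by (simp only: sum_lessThan_add) (simp add: ac_simps)
  then show ?case
    by (simp add: assms sum_negf)
qed simp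

lemma antiperiodic_even_multiple:
  fixes q :: "nat \<Rightarrow> 'a::ab_group_add"
  assumes "\<And>t. q (t + l) = - q t"
  shows "q (t + 2 * l * c) = q t"
proof (induction c)
  case (Suc c)
  have "q (t + 2 * l * Suc c) = q ((t + 2 * l * c) + l + l)" by (simp add: algebra_simps)
  also have "\<dots> = q (t + 2 * l * c)" by (simp only: assms minus_minus)
  finally show ?case using Suc by simp
qed simp

text \<open>Averaging along the step \<open>2 p\<^sub>m\<close> kills the terms with \<open>n > m\<close>, since their antiperiods are
  even multiples of \<open>p\<^sub>m\<close>, and fixes those with \<open>n \<le> m\<close>; translating by \<open>p\<^sub>m\<close> then changes the sign
  of the \<open>m\<close>-th term only.\<close>

lemma norm_antiperiodic_component_le:
  fixes d :: "nat \<Rightarrow> nat \<Rightarrow> 'k::real_normed_field" and p :: "nat \<Rightarrow> nat"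
  assumes anti: "\<And>n k. n \<in> {1..N} \<Longrightarrow> d n (k + p n) = - d n k"
    and up: "\<And>n. n \<in> {m<..N} \<Longrightarrow> 2 * p m dvd p n \<and> p n dvd p N"
    and down: "\<And>n. n \<in> {1..<m} \<Longrightarrow> 2 * p n dvd p m"
    and m: "1 \<le> m" "m \<le> N" and pos: "0 < p m" "0 < p N"
    and le: "\<And>k'. k \<le> k' \<Longrightarrow> k' \<le> k + 2 * p m * p N + p m \<Longrightarrow> norm ((\<Sum>n=1..N. d n k') - L) \<le> \<epsilon>"
  shows "norm (d m k) \<le> \<epsilon>"
proof -
  have avg: "norm ((\<Sum>n=1..m. d n k') - L) \<le> \<epsilon>" if k': "k \<le> k'" "k' \<le> k + p m" for k'
  proof -
    have high: "(\<Sum>t<p N. d n (k' + 2 * p m * t)) = 0" if n: "n \<in> {m<..N}" for n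
    proof -
      obtain l where l: "p n = 2 * p m * l" using up[OF n] by (auto elim: dvdE)
      \<comment> \<open>Here \<open>p n = 2 * p m * l\<close> divides \<open>p N\<close>. In the
        variable t the n-th term has antiperiod l, so the \<open>p N\<close> summands form whole
        periods of length \<open>2 * l\<close> and cancel.\<close>
      have "2 * l dvd p N"
        using up[OF n] l by (metis dvd_trans dvd_triv_right mult.assoc mult.commute)
      then obtain c where c: "p N = 2 * l * c" by (auto elim: dvdE)
      have "d n (k' + 2 * p m * (t + l)) = - d n (k' + 2 * p m * t)" for t
        using anti[of n "k' + 2 * p m * t"] n m l by (simp add: algebra_simps)
      then show ?thesis
        unfolding c by (rule sum_antiperiodic)
    qed
    have low: "d n (k' + 2 * p m * t) = d n k'" if n: "n \<in> {1..m}" for n t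
    proof -
      have "p n dvd p m" using down[of n] n by (cases "n = m") (auto elim: dvd_mult_right)
      then obtain c where "p m = p n * c" by (auto elim: dvdE)
      then have eq: "k' + 2 * p m * t = k' + 2 * p n * (c * t)" by simp
      show ?thesis
        unfolding eq using antiperiodic_even_multiple[of "d n" "p n" k' "c * t"] anti n m by simp
    qed
    have "(\<Sum>t<p N. \<Sum>n=1..N. d n (k' + 2 * p m * t)) = (\<Sum>n=1..N. \<Sum>t<p N. d n (k' + 2 * p m * t))"
      by (rule sum.swap)
    also have "\<dots> = (\<Sum>n=1..m. \<Sum>t<p N. d n (k' + 2 * p m * t))"
      using m high by (intro sum.mono_neutral_right) auto
    also have "\<dots> = of_nat (p N) * (\<Sum>n=1..m. d n k')"
      by (simp add: low sum_distrib_left)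
    finally have "of_nat (p N) * ((\<Sum>n=1..m. d n k') - L)
        = (\<Sum>t<p N. (\<Sum>n=1..N. d n (k' + 2 * p m * t)) - L)"
      by (simp add: sum_subtractf algebra_simps)
    also have "norm \<dots> \<le> (\<Sum>t<p N. \<epsilon>)"
    proof (intro sum_norm_le le)
      fix t assume "t \<in> {..<p N}"
      \<comment> \<open>The length of the window in the hypothesis \<open>le\<close> comes from
        here: fewer than \<open>p N\<close> steps of length \<open>2 * p m\<close>, started anywhere
        in a range of length \<open>p m\<close>.\<close>
      then have "2 * p m * t \<le> 2 * p m * p N" by simp
      then show "k' + 2 * p m * t \<le> k + 2 * p m * p N + p m" "k \<le> k' + 2 * p m * t"
        using k' by linarith+
    qed
    finally have "real (p N) * norm ((\<Sum>n=1..m. d n k') - L) \<le> real (p N) * \<epsilon>"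
      by (simp add: norm_mult)
    then show ?thesis using pos by simp
  qed
  have inv: "d n (k + p m) = d n k" if n: "n \<in> {1..<m}" for n
  proof -
    obtain c where "p m = 2 * p n * c" using down[OF n] by (auto elim: dvdE)
    then show ?thesis
      using antiperiodic_even_multiple[of "d n" "p n" k c] anti n m by simp
  qed
  have split: "{1..m} = insert m {1..<m}" using m by auto
  have "2 * d m k = ((\<Sum>n=1..m. d n k) - L) - ((\<Sum>n=1..m. d n (k + p m)) - L)"
    using anti[of m k] m unfolding split by (simp add: inv)
  also have "norm \<dots> \<le> \<epsilon> + \<epsilon>"
    by (intro norm_triangle_le_diff add_mono avg) auto
  finally show ?thesis by (simp add: norm_mult)
qed

section \<open>Blocks and the coefficient matrix\<close>

lemma block_elem_eq_iff [simp]: "block_elem p n i = block_elem p n j \<longleftrightarrow> i = j"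
  by (simp add: block_elem_def)

lemma block_eq: "block p n = (\<lambda>j. block_elem p n (j + 1)) ` {..<p n}"
proof -
  have "{1..p n} = Suc ` {..<p n}" by (auto simp: image_iff) (metis Suc_le_D lessThan_iff Suc_le_lessD)
  then show ?thesis by (simp add: block_def image_image)
qed

lemma finite_block [simp]: "finite (block p n)"
  by (simp add: block_def)

lemma sum_block: "(\<Sum>m\<in>block p n. F m) = (\<Sum>j<p n. F (block_elem p n (j + 1)))"
  unfolding block_eq by (subst sum.reindex) (auto simp: inj_on_def)

lemma block_less:
  assumes "1 \<le> n" "n < n'" "m \<in> block p n" "m' \<in> block p n'"
  shows "m < m'"
proof -
  have "{1..<Suc n} = insert n {1..<n}" using assms by auto
  then have "m \<le> (\<Sum>i\<in>{1..<Suc n}. p i)"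
    using assms(3) by (auto simp: block_def block_elem_def)
  also have "\<dots> \<le> (\<Sum>i\<in>{1..<n'}. p i)"
    using assms(2) by (intro sum_mono2) auto
  also have "\<dots> < m'" using assms(4) by (auto simp: block_def block_elem_def)
  finally show ?thesis .
qed

lemma atLeastAtMost_sum_eq_Union_block: "{1..\<Sum>n=1..N. p n} = (\<Union>n\<in>{1..N}. block p n)"
proof (induction N)
  case (Suc N)
  have "{1..\<Sum>n=1..Suc N. p n} = {1..\<Sum>n=1..N. p n} \<union> (\<lambda>j. (\<Sum>n=1..N. p n) + j) ` {1..p (Suc N)}"
    by (auto simp: image_iff)
  also have "(\<lambda>j. (\<Sum>n=1..N. p n) + j) ` {1..p (Suc N)} = block p (Suc N)"
    by (simp add: block_def block_elem_def atLeastLessThanSuc_atLeastAtMost)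
  finally show ?case using Suc by (auto simp: atLeastAtMostSuc_conv)
qed simp

lemma block_shift_block_elem:
  assumes "j < p n"
  shows "block_shift p n (block_elem p n (j + 1)) =
    (if j = 0 then block_elem p n (p n) else block_elem p n j)"
  using assms by (auto simp: block_shift_def) (simp add: block_elem_def)

text \<open>The matrix is negacyclic: row i is the first row moved i places to the right, with a
  minus sign on the entries that wrap around. The same sign appears when an antiperiodic q is read
  past \<open>p n\<close>, so row i pairs the coefficients with the translate of q by i.\<close>

lemma coeff_matrix_mult_vec:
  fixes \<gamma> :: "nat \<Rightarrow> 'k::real_normed_field"
  assumes anti: "\<And>t. q (t + p n) = - q t" and i: "i < p n"
  shows "(\<Sum>j<p n. coeff_matrix p \<gamma> n $$ (i, j) * q j) =
    (\<Sum>j<p n. \<gamma> (block_elem p n (j + 1)) * q (j + i))"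
proof -
  \<comment> \<open>The number of columns on or to the right of the diagonal in row i; the i columns
    to the left become the last i summands after reordering.\<close>
  define r where "r = p n - i"
  have pn: "p n = i + r" "p n = r + i" and r: "0 < r" using i by (auto simp: r_def)
  let ?c = "\<lambda>j. coeff_matrix p \<gamma> n $$ (i, j) * q j"
  let ?b = "\<lambda>j. \<gamma> (block_elem p n (j + 1)) * q (j + i)"
  have "sum ?c {..<p n} = sum ?c {..<i + r}" by (simp only: pn(1)[symmetric])
  also have "\<dots> = (\<Sum>j<i. ?c j) + (\<Sum>j<r. ?c (i + j))"
    by (rule sum_lessThan_add)
  also have "(\<Sum>j<i. ?c j) = (\<Sum>j<i. ?b (r + j))"
  proof (rule sum.cong[OF refl])
    fix j assume j: "j \<in> {..<i}"
    have "p n - (i - j) + 1 = r + j + 1" using j i by (auto simp: r_def)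
    moreover have "q (r + j + i) = - q j" using anti[of j] pn by (simp add: ac_simps)
    ultimately show "?c j = ?b (r + j)" using j i by (simp add: coeff_matrix_def)
  qed
  also have "(\<Sum>j<r. ?c (i + j)) = (\<Sum>j<r. ?b j)"
  proof (rule sum.cong[OF refl])
    fix j assume j: "j \<in> {..<r}"
    then have "i + j < p n" using pn by simp
    then show "?c (i + j) = ?b j" using i by (simp add: coeff_matrix_def ac_simps)
  qed
  also have "(\<Sum>j<i. ?b (r + j)) + (\<Sum>j<r. ?b j) = sum ?b {..<r + i}"
    unfolding sum_lessThan_add[of ?b r i] by (rule add.commute)
  finally show ?thesis by (simp only: pn(2)[symmetric])
qed

text \<open>Vanishing pairings with all translates say that the matrix annihilates the vector of the
  first \<open>p n\<close> values of q.\<close>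

lemma antiperiodic_eq_0:
  fixes \<gamma> :: "nat \<Rightarrow> 'k::real_normed_field"
  assumes anti: "\<And>t. q (t + p n) = - q t"
    and det: "Determinant.det (coeff_matrix p \<gamma> n) \<noteq> 0"
    and 0: "\<And>i. (\<Sum>j<p n. \<gamma> (block_elem p n (j + 1)) * q (j + i)) = 0"
    and j: "j < p n"
  shows "q j = 0"
proof -
  let ?M = "coeff_matrix p \<gamma> n"
  let ?v = "Matrix.vec (p n) q"
  have M: "?M \<in> carrier_mat (p n) (p n)" by (simp add: coeff_matrix_def)
  have "?M *\<^sub>v ?v = 0\<^sub>v (p n)"
  proof (rule eq_vecI)
    fix i assume "i < dim_vec (0\<^sub>v (p n) :: 'k Matrix.vec)"
    then have i: "i < p n" by simp
    have "(?M *\<^sub>v ?v) $ i = (\<Sum>j<p n. ?M $$ (i, j) * q j)"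
      using M i by (auto simp: scalar_prod_def lessThan_atLeast0 intro!: sum.cong)
    then show "(?M *\<^sub>v ?v) $ i = 0\<^sub>v (p n) $ i"
      using coeff_matrix_mult_vec[of q p n i \<gamma>, OF anti i] 0 i by simp
  qed (use M in auto)
  then have "?v = 0\<^sub>v (p n)"
    using det det_0_iff_vec_prod_zero_field[OF M] vec_carrier by blast
  then have "?v $ j = 0\<^sub>v (p n) $ j" by simp
  then show ?thesis using j by simp
qed

section \<open>Orbits in \<open>\<omega>X\<^sub>0\<close>\<close>

text \<open>The data without scalars, so that the count of generators is shared by the real and the
  complex case.\<close>

locale shift_space =
  fixes P :: "nat set" and p :: "nat \<Rightarrow> nat"
    and Z :: "nat \<Rightarrow> 'z topology" and h :: "nat \<Rightarrow> 'z \<Rightarrow> 'z" and pt :: "nat \<Rightarrow> 'z"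
    and W :: "'w topology" and e :: "nat \<times> nat \<times> 'z \<Rightarrow> 'w" and \<phi> :: "'w \<Rightarrow> 'w"
  assumes initial: "initial_index_set P"
    and compatible: "compatible_sequence P p"
    and family: "basic_family P Z h pt"
    and transitive: "transitive_family {2 * p n | n. n \<in> P} P Z h pt"
    and compactif: "compactification (space_X0 P p Z) W e"
    and phi_ext: "phi_extension P p Z h W e \<phi>"
begin

abbreviation "X0 \<equiv> space_X0 P p Z"

abbreviation "\<psi> \<equiv> inv_into (topspace W) \<phi>"

lemma P_ge_1: "n \<in> P \<Longrightarrow> 1 \<le> n"
  using initial by (auto simp: initial_index_set_def)

lemma one_in_P: "1 \<in> P"
  using initial by (auto simp: initial_index_set_def)

lemma P_downward_closed: "n \<in> P \<Longrightarrow> 1 \<le> m \<Longrightarrow> m \<le> n \<Longrightarrow> m \<in> P"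
  using initial by (auto simp: initial_index_set_def)

lemma p_pos: "n \<in> P \<Longrightarrow> 0 < p n"
  using compatible by (auto simp: compatible_sequence_def)

lemma double_p_dvd:
  assumes "1 \<le> m" "m < n" "n \<in> P"
  shows "2 * p m dvd p n"
  using assms(2,3)
proof (induction n)
  case (Suc n)
  then have n: "n \<in> P" "n + 1 \<in> P" using P_downward_closed[of "Suc n" n] assms(1) by auto
  then have "P \<noteq> {1}" using Suc assms(1) by auto
  then obtain l where l: "p (n + 1) = 2 * l * p n"
    using compatible n by (auto simp: compatible_sequence_def)
  show ?case
  proof (cases "m = n")
    case True
    then show ?thesis using l by simp
  next
    case False
    then have "2 * p m dvd p n" using Suc n by auto
    then show ?thesis using l by simp
  qed
qed simp

lemma in_X0 [simp]: "(n, m, z) \<in> topspace X0 \<longleftrightarrow> n \<in> P \<and> m \<in> block p n \<and> z \<in> topspace (Z n)"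
  by (auto simp: space_X0_def)

section \<open>Dense orbits in the spaces Z_n\<close>

lemma homeomorphic_h: "n \<in> P \<Longrightarrow> homeomorphic_map (Z n) (Z n) (h n)"
  and pt_in: "n \<in> P \<Longrightarrow> pt n \<in> topspace (Z n)"
  and dense_forward_orbit: "n \<in> P \<Longrightarrow> Z n closure_of {(h n ^^ k) (pt n) | k. 1 \<le> k} = topspace (Z n)"
  using family by (auto simp: basic_family_def)

lemma h_in: "n \<in> P \<Longrightarrow> z \<in> topspace (Z n) \<Longrightarrow> h n z \<in> topspace (Z n)"
  using homeomorphic_imp_surjective_map[OF homeomorphic_h] by blast

lemma inv_h: "n \<in> P \<Longrightarrow> z \<in> topspace (Z n) \<Longrightarrow> inv_into (topspace (Z n)) (h n) (h n z) = z"
  using homeomorphic_imp_injective_map[OF homeomorphic_h] by simp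

lemma funpow_h_in: "n \<in> P \<Longrightarrow> z \<in> topspace (Z n) \<Longrightarrow> (h n ^^ k) z \<in> topspace (Z n)"
  by (induction k) (auto simp: h_in)

lemma continuous_funpow_h: "n \<in> P \<Longrightarrow> continuous_map (Z n) (Z n) (h n ^^ k)"
proof (induction k)
  case (Suc k)
  have "continuous_map (Z n) (Z n) (h n \<circ> (h n ^^ k))"
    by (intro continuous_map_compose[of _ "Z n"] Suc homeomorphic_imp_continuous_map[OF homeomorphic_h])
  then show ?case by (simp only: funpow.simps)
qed (simp add: id_def)

lemma dense_funpow_h_image:
  assumes n: "n \<in> P" and S: "S \<subseteq> topspace (Z n)" "Z n closure_of S = topspace (Z n)"
  shows "Z n closure_of ((h n ^^ k) ` S) = topspace (Z n)"
proof (induction k)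
  case (Suc k)
  have "(h n ^^ k) ` S \<subseteq> topspace (Z n)"
    using S(1) funpow_h_in[OF n] by auto
  then have "Z n closure_of (h n ` (h n ^^ k) ` S) = h n ` (Z n closure_of ((h n ^^ k) ` S))"
    by (rule homeomorphic_map_closure_of[OF homeomorphic_h[OF n]])
  then show ?case
    using Suc homeomorphic_imp_surjective_map[OF homeomorphic_h[OF n]] by (simp add: image_comp)
qed (use S in simp)

text \<open>The tail contains the image of the whole forward orbit under \<open>h n ^^ l\<close>,
  and a homeomorphism preserves density.\<close>

lemma dense_orbit_tail:
  assumes n: "n \<in> P"
  shows "Z n closure_of {(h n ^^ k) (pt n) | k. l < k} = topspace (Z n)"
proof -
  have "(h n ^^ l) ` {(h n ^^ k) (pt n) | k. 1 \<le> k} \<subseteq> {(h n ^^ k) (pt n) | k. l < k}"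
  proof clarify
    fix k :: nat assume "1 \<le> k"
    then show "\<exists>k'. (h n ^^ l) ((h n ^^ k) (pt n)) = (h n ^^ k') (pt n) \<and> l < k'"
      by (intro exI[of _ "l + k"]) (simp add: funpow_add)
  qed
  then have "topspace (Z n) \<subseteq> Z n closure_of {(h n ^^ k) (pt n) | k. l < k}"
    using dense_funpow_h_image[OF n _ dense_forward_orbit[OF n], of l] funpow_h_in[OF n pt_in[OF n]]
      closure_of_mono by fastforce
  then show ?thesis by (simp add: closure_of_subset_topspace subset_antisym)
qed

text \<open>Projecting transitivity to the coordinate n puts every point of the forward orbit in the
  closure of the times divisible by \<open>2 * p n\<close>; applying \<open>h n ^^ j\<close> then
  reaches the residue class of j. At these times an orbit in X_n returns to the same sheet, so each
  sheet is filled densely.\<close>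

lemma dense_orbit_progression:
  assumes n: "n \<in> P"
  shows "Z n closure_of {(h n ^^ (2 * p n * t + j)) (pt n) | t. 1 \<le> t} = topspace (Z n)"
proof -
  let ?S = "{(h n ^^ (2 * p n * t)) (pt n) | t. 1 \<le> t}"
  have S: "?S \<subseteq> topspace (Z n)" using funpow_h_in[OF n pt_in[OF n]] by auto
  have "(h n ^^ i) (pt n) \<in> Z n closure_of ?S" if i: "1 \<le> i" for i
  proof -
    let ?Y = "product_topology Z P"
    have "(\<lambda>n\<in>P. (h n ^^ i) (pt n)) \<in> ?Y closure_of {(\<lambda>m\<in>P. (h m ^^ (2 * p n * t)) (pt m)) | t. 1 \<le> t}"
      using transitive n i unfolding transitive_family_def by blast
    from subsetD[OF continuous_map_image_closure_subset[OF continuous_map_product_projection[OF n]] imageI[OF this]]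
    have "(\<lambda>n\<in>P. (h n ^^ i) (pt n)) n
        \<in> Z n closure_of ((\<lambda>y. y n) ` {(\<lambda>m\<in>P. (h m ^^ (2 * p n * t)) (pt m)) | t. 1 \<le> t})" .
    moreover have "(\<lambda>y. y n) ` {(\<lambda>m\<in>P. (h m ^^ (2 * p n * t)) (pt m)) | t. 1 \<le> t} \<subseteq> ?S"
      using n by auto
    ultimately show ?thesis
      using n closure_of_mono by fastforce
  qed
  then have "Z n closure_of {(h n ^^ k) (pt n) | k. 1 \<le> k} \<subseteq> Z n closure_of ?S"
    by (intro closure_of_minimal) auto
  then have "Z n closure_of ?S = topspace (Z n)"
    using dense_forward_orbit[OF n] by (simp add: closure_of_subset_topspace subset_antisym)
  then have "Z n closure_of ((h n ^^ j) ` ?S) = topspace (Z n)"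
    by (rule dense_funpow_h_image[OF n S])
  moreover have "(h n ^^ j) ` ?S = {(h n ^^ (2 * p n * t + j)) (pt n) | t. 1 \<le> t}"
    unfolding add.commute[of _ j] by (auto simp: funpow_add)
  ultimately show ?thesis by simp
qed

section \<open>The compactification and its homeomorphism\<close>

lemma compact_W: "compact_space W" and Hausdorff_W: "Hausdorff_space W"
  and dense_e: "W closure_of (e ` topspace X0) = topspace W"
  using compactif by (auto simp: compactification_def)

lemma homeomorphic_e: "homeomorphic_map X0 (subtopology W (e ` topspace X0)) e"
  using compactif by (auto simp: compactification_def embedding_map_def)

lemma continuous_e: "continuous_map X0 W e"
  using homeomorphic_imp_continuous_map[OF homeomorphic_e] by (simp add: continuous_map_in_subtopology)

lemma inj_on_e: "inj_on e (topspace X0)"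
  using homeomorphic_imp_injective_map[OF homeomorphic_e] .

lemma e_in: "y \<in> topspace X0 \<Longrightarrow> e y \<in> topspace W"
  using continuous_map_funspace[OF continuous_e] by blast

lemma continuous_e_slice:
  assumes "n \<in> P" "m \<in> block p n"
  shows "continuous_map (Z n) W (\<lambda>z. e (n, m, z))"
proof -
  have "continuous_map (Z n) (prod_topology (discrete_topology (block p n)) (Z n)) (\<lambda>z. (m, z))"
    using assms by (auto intro: continuous_map_pairedI)
  moreover have "continuous_map (prod_topology (discrete_topology (block p n)) (Z n)) X0 (\<lambda>y. (n, y))"
    using continuous_map_component_injection[OF assms(1),
        of "\<lambda>n. prod_topology (discrete_topology (block p n)) (Z n)"]
    by (simp add: space_X0_def)
  ultimately have "continuous_map (Z n) X0 ((\<lambda>y. (n, y)) \<circ> (\<lambda>z. (m, z)))"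
    by (rule continuous_map_compose)
  then have "continuous_map (Z n) X0 (\<lambda>z. (n, m, z))" by (simp add: o_def)
  from continuous_map_compose[OF this continuous_e] show ?thesis by (simp add: o_def)
qed

lemma homeomorphic_phi: "homeomorphic_map W W \<phi>"
  and phi_e: "y \<in> topspace X0 \<Longrightarrow> \<phi> (e y) = e (phi_X0 p Z h y)"
  using phi_ext by (auto simp: phi_extension_def)

lemma homeomorphic_phi_psi: "homeomorphic_maps W W \<phi> \<psi>"
proof -
  obtain g where g: "homeomorphic_maps W W \<phi> g"
    using homeomorphic_phi homeomorphic_map_maps by blast
  then have "\<psi> w = g w" if "w \<in> topspace W" for w
    using that homeomorphic_imp_injective_map[OF homeomorphic_phi]
    by (intro inv_into_f_eq) (auto simp: homeomorphic_maps_def continuous_map_def)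
  then show ?thesis
    using g homeomorphic_maps_eq by metis
qed

lemma phi_in: "w \<in> topspace W \<Longrightarrow> \<phi> w \<in> topspace W"
  and psi_in: "w \<in> topspace W \<Longrightarrow> \<psi> w \<in> topspace W"
  and psi_phi: "w \<in> topspace W \<Longrightarrow> \<psi> (\<phi> w) = w"
  and phi_psi: "w \<in> topspace W \<Longrightarrow> \<phi> (\<psi> w) = w"
  using homeomorphic_phi_psi by (auto simp: homeomorphic_maps_def continuous_map_def)

text \<open>The points of \<open>A\<^sub>n\<close> are indexed cyclically by \<open>j mod p n\<close>, starting from \<open>0\<close>.\<close>

definition point :: "nat \<Rightarrow> nat \<Rightarrow> 'z \<Rightarrow> 'w" where
  "point n j z = e (n, block_elem p n (j mod p n + 1), z)"

lemma block_elem_mod_in: "n \<in> P \<Longrightarrow> block_elem p n (j mod p n + 1) \<in> block p n"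
  using p_pos by (auto simp: block_eq)

lemma point_in: "n \<in> P \<Longrightarrow> z \<in> topspace (Z n) \<Longrightarrow> point n j z \<in> topspace W"
  unfolding point_def by (intro e_in) (simp add: block_elem_mod_in[simplified])

lemma X0_cases:
  assumes "y \<in> topspace X0"
  obtains n j z where "n \<in> P" "j < p n" "z \<in> topspace (Z n)" "y = (n, block_elem p n (j + 1), z)"
    "e y = point n j z"
proof -
  obtain n m z where y: "y = (n, m, z)" by (cases y) auto
  then have "n \<in> P" "m \<in> block p n" "z \<in> topspace (Z n)" using assms by auto
  then show ?thesis using that y by (auto simp: block_eq point_def)
qed

text \<open>Raising both the index and the iterate on the left avoids a predecessor of 0 and the
  inverse of \<open>h n\<close>.\<close>

lemma phi_point:
  assumes n: "n \<in> P" and z: "z \<in> topspace (Z n)"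
  shows "\<phi> (point n (Suc j) (h n z)) = point n j z"
proof -
  let ?i = "Suc j mod p n"
  have i: "?i < p n" using p_pos[OF n] by simp
  have "\<phi> (point n (Suc j) (h n z)) =
      e (phi_X0 p Z h (n, block_elem p n (?i + 1), h n z))"
    unfolding point_def using n z h_in block_elem_mod_in[OF n, of "Suc j"] by (intro phi_e) simp
  also have "\<dots> = e (n, (if ?i = 0 then block_elem p n (p n) else block_elem p n ?i), z)"
    unfolding phi_X0_def using block_shift_block_elem[of ?i p n] i inv_h[OF n z] by simp
  \<comment> \<open>If \<open>Suc j\<close> is divisible by \<open>p n\<close>, then j has residue
    \<open>p n - 1\<close>, and its position counted from 1 is the last one.\<close>
  also have "(if ?i = 0 then block_elem p n (p n) else block_elem p n ?i) = block_elem p n (j mod p n + 1)"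
    using p_pos[OF n] by (auto simp: mod_Suc split: if_splits)
  finally show ?thesis by (simp add: point_def)
qed

lemma psi_point:
  assumes n: "n \<in> P" and z: "z \<in> topspace (Z n)"
  shows "\<psi> (point n j z) = point n (Suc j) (h n z)"
  using phi_point[OF assms, of j] psi_phi[OF point_in[OF n h_in[OF n z], of "Suc j"]] by simp

lemma funpow_psi_point:
  assumes n: "n \<in> P" and z: "z \<in> topspace (Z n)"
  shows "(\<psi> ^^ k) (point n j z) = point n (j + k) ((h n ^^ k) z)"
  by (induction k) (use assms in \<open>auto simp: psi_point funpow_h_in\<close>)

section \<open>Orbits and the number of generators\<close>

definition orbit :: "'w \<Rightarrow> 'w set" where
  "orbit w = {(\<phi> ^^ k) w | k. True} \<union> {(\<psi> ^^ k) w | k. True}"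

lemma orbit_subset:
  assumes "w \<in> S" "\<And>w. w \<in> S \<Longrightarrow> \<phi> w \<in> S" "\<And>w. w \<in> S \<Longrightarrow> \<psi> w \<in> S"
  shows "orbit w \<subseteq> S"
proof -
  have "(\<phi> ^^ k) w \<in> S" "(\<psi> ^^ k) w \<in> S" for k
    by (induction k) (use assms in auto)
  then show ?thesis by (auto simp: orbit_def)
qed

lemma inv_phi_X_Inl:
  assumes "w \<in> topspace W"
  shows "inv_into (topspace (space_X W) - {point_one}) (phi_X \<phi>) (Inl w) = Inl (\<psi> w)"
proof (rule inv_into_f_eq)
  have "homeomorphic_map (subtopology (space_X W) (topspace (space_X W) - {point_one})) (space_X W) (phi_X \<phi>)"
    using homeomorphic_maps_phi_X[OF homeomorphic_phi_psi] homeomorphic_maps_imp_map by blast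
  from homeomorphic_imp_injective_map[OF this]
  show "inj_on (phi_X \<phi>) (topspace (space_X W) - {point_one})" by (simp add: Int_absorb1)
qed (use assms psi_in phi_psi in auto)

lemma orbit_Z_Inl:
  assumes w: "w \<in> topspace W"
  shows "orbit_Z (space_X W) point_one (phi_X \<phi>) (Inl w) = Inl ` orbit w"
proof -
  have "(phi_X \<phi> ^^ k) (Inl w) = Inl ((\<phi> ^^ k) w)" for k
    by (induction k) auto
  moreover have "(\<psi> ^^ k) w \<in> topspace W \<and>
    (inv_into (topspace (space_X W) - {point_one}) (phi_X \<phi>) ^^ k) (Inl w) = Inl ((\<psi> ^^ k) w)" for k
    by (induction k) (use w psi_in inv_phi_X_Inl in auto)
  ultimately show ?thesis
    unfolding orbit_Z_def orbit_def image_Un by (auto simp: image_def)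
qed

text \<open>On the copy of W, \<open>phi_X\<close> and its inverse act as \<phi> and \<psi>, and
  closures are formed inside W, so every reference to N disappears.\<close>

lemma generated_by_iff:
  "generated_by (space_X W) point_one nat_points (phi_X \<phi>) n \<longleftrightarrow>
    (\<exists>x. (\<forall>i\<in>{1..n}. x i \<in> topspace W) \<and> W closure_of (\<Union>i\<in>{1..n}. orbit (x i)) = topspace W)"
proof -
  have eq: "subtopology (space_X W) (Inl ` topspace W) closure_of
        (\<Union>i\<in>{1..n}. orbit_Z (space_X W) point_one (phi_X \<phi>) (Inl (x i))) = Inl ` topspace W
      \<longleftrightarrow> W closure_of (\<Union>i\<in>{1..n}. orbit (x i)) = topspace W"
    if x: "\<forall>i\<in>{1..n}. x i \<in> topspace W" for x
  proof -
    have "orbit (x i) \<subseteq> topspace W" if "i \<in> {1..n}" for i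
      using x that by (intro orbit_subset) (auto simp: phi_in psi_in)
    then have sub: "Inl ` (\<Union>i\<in>{1..n}. orbit (x i)) \<subseteq> Inl ` topspace W" by blast
    have "(\<Union>i\<in>{1..n}. orbit_Z (space_X W) point_one (phi_X \<phi>) (Inl (x i)))
        = Inl ` (\<Union>i\<in>{1..n}. orbit (x i))"
      using x by (simp add: orbit_Z_Inl image_UN)
    then have "subtopology (space_X W) (Inl ` topspace W) closure_of
        (\<Union>i\<in>{1..n}. orbit_Z (space_X W) point_one (phi_X \<phi>) (Inl (x i)))
      = Inl ` topspace W \<inter> space_X W closure_of (Inl ` (\<Union>i\<in>{1..n}. orbit (x i)))"
      by (simp only: closure_of_subtopology Int_absorb1[OF sub])
    also have "\<dots> = Inl ` (W closure_of (\<Union>i\<in>{1..n}. orbit (x i)))"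
      unfolding space_X_def closure_of_plus_topology_Inl using closure_of_subset_topspace by fastforce
    finally show ?thesis by (simp only: inj_image_eq_iff[OF inj_Inl])
  qed
  show ?thesis
  proof
    assume "generated_by (space_X W) point_one nat_points (phi_X \<phi>) n"
    then obtain x where x: "\<forall>i\<in>{1..n}. x i \<in> Inl ` topspace W"
      and cl: "subtopology (space_X W) (Inl ` topspace W) closure_of
        (\<Union>i\<in>{1..n}. orbit_Z (space_X W) point_one (phi_X \<phi>) (x i)) = Inl ` topspace W"
      unfolding generated_by_def space_X_minus_closure_of_nat_points by blast
    then have "\<forall>i\<in>{1..n}. projl (x i) \<in> topspace W \<and> x i = Inl (projl (x i))" by force
    then show "\<exists>x. (\<forall>i\<in>{1..n}. x i \<in> topspace W) \<and> W closure_of (\<Union>i\<in>{1..n}. orbit (x i)) = topspace W"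
      using eq[of "\<lambda>i. projl (x i)"] cl by (intro exI[of _ "\<lambda>i. projl (x i)"]) auto
  next
    assume "\<exists>x. (\<forall>i\<in>{1..n}. x i \<in> topspace W) \<and> W closure_of (\<Union>i\<in>{1..n}. orbit (x i)) = topspace W"
    then obtain x where "\<forall>i\<in>{1..n}. x i \<in> topspace W"
      "W closure_of (\<Union>i\<in>{1..n}. orbit (x i)) = topspace W" by blast
    then show "generated_by (space_X W) point_one nat_points (phi_X \<phi>) n"
      unfolding generated_by_def space_X_minus_closure_of_nat_points
      using eq[of x] by (intro exI[of _ "\<lambda>i. Inl (x i)"]) auto
  qed
qed

text \<open>One generator per block suffices: at time \<open>2 * p n * t + j\<close> the
  \<psi>-orbit of the point 1_n on the first sheet is on the sheet with index j, and these visits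
  are dense in it.\<close>

lemma generated_by_N:
  assumes "P = {1..N}"
  shows "generated_by (space_X W) point_one nat_points (phi_X \<phi>) N"
  unfolding generated_by_iff
proof (intro exI conjI ballI)
  let ?x = "\<lambda>i. point i 0 (pt i)"
  let ?C = "W closure_of (\<Union>i\<in>{1..N}. orbit (?x i))"
  show "?x i \<in> topspace W" if "i \<in> {1..N}" for i
    using that assms point_in pt_in by auto
  have "e y \<in> ?C" if "y \<in> topspace X0" for y
    using that
  proof (cases rule: X0_cases)
    case (1 n j z)
    let ?S = "{(h n ^^ (2 * p n * t + j)) (pt n) | t. 1 \<le> t}"
    have cont: "continuous_map (Z n) W (point n j)"
      unfolding point_def using 1 by (intro continuous_e_slice block_elem_mod_in)
    have "point n j ((h n ^^ (2 * p n * t + j)) (pt n)) = (\<psi> ^^ (2 * p n * t + j)) (?x n)" for t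
    proof -
      have "(2 * p n * t + j) mod p n = j mod p n"
        using mod_mult_self2[of j "p n" "2 * t"] by (simp add: ac_simps)
      then show ?thesis
        using 1 funpow_psi_point[of n "pt n" "2 * p n * t + j" 0] pt_in by (simp add: point_def)
    qed
    then have "point n j ` ?S \<subseteq> orbit (?x n)" by (auto simp: orbit_def)
    also have "orbit (?x n) \<subseteq> (\<Union>i\<in>{1..N}. orbit (?x i))"
      using 1(1) assms by blast
    finally have "W closure_of (point n j ` ?S) \<subseteq> ?C" by (rule closure_of_mono)
    moreover have "z \<in> Z n closure_of ?S"
      using dense_orbit_progression 1 by simp
    ultimately show ?thesis
      using continuous_map_image_closure_subset[OF cont] 1(5) by blast
  qed
  then have "W closure_of (e ` topspace X0) \<subseteq> ?C"
    by (intro closure_of_minimal) auto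
  then show "?C = topspace W"
    by (simp add: dense_e closure_of_subset_topspace subset_antisym)
qed

definition part :: "nat set \<Rightarrow> 'w set" where
  "part R = W closure_of (e ` {y \<in> topspace X0. fst y \<in> R})"

text \<open>Closures of pieces over disjoint index sets may meet in the remainder of W, so
  separation is claimed for points of X0 only. There it holds because the piece over the complement
  of R is open in X0, hence the trace of an open set of W.\<close>

lemma e_notin_part:
  assumes y: "y \<in> topspace X0" "fst y \<notin> R"
  shows "e y \<notin> part R"
proof -
  let ?U = "{y \<in> topspace X0. fst y \<notin> R}"
  have "openin X0 ?U"
    unfolding space_X0_def openin_sum_topology
  proof (intro conjI ballI)
    fix n assume "n \<in> P"
    have eq: "{x. (n, x) \<in> {y \<in> topspace (sum_topology (\<lambda>n. prod_topology (discrete_topology (block p n)) (Z n)) P). fst y \<notin> R}}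
      = (if n \<in> R then {} else topspace (prod_topology (discrete_topology (block p n)) (Z n)))"
      using \<open>n \<in> P\<close> by auto
    show "openin (prod_topology (discrete_topology (block p n)) (Z n))
      {x. (n, x) \<in> {y \<in> topspace (sum_topology (\<lambda>n. prod_topology (discrete_topology (block p n)) (Z n)) P). fst y \<notin> R}}"
      unfolding eq by (simp del: topspace_prod_topology)
  qed auto
  then have "openin (subtopology W (e ` topspace X0)) (e ` ?U)"
    using homeomorphic_imp_open_map[OF homeomorphic_e] by (simp add: open_map_def)
  then obtain V where V: "openin W V" "e ` ?U = V \<inter> e ` topspace X0"
    by (auto simp: openin_subtopology)
  have "V \<inter> e ` {y \<in> topspace X0. fst y \<in> R} = {}"
  proof -
    have "V \<inter> e ` {y \<in> topspace X0. fst y \<in> R} \<subseteq> e ` ?U \<inter> e ` {y \<in> topspace X0. fst y \<in> R}"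
      using V by blast
    also have "\<dots> = e ` (?U \<inter> {y \<in> topspace X0. fst y \<in> R})"
      by (rule inj_on_image_Int[OF inj_on_e, symmetric]) auto
    finally show ?thesis by auto
  qed
  moreover have "e y \<in> V" using V y by blast
  ultimately show ?thesis
    unfolding part_def in_closure_of using V(1) by blast
qed

lemma closedin_part: "closedin W (part R)"
  by (simp add: part_def)

lemma part_mono: "R \<subseteq> R' \<Longrightarrow> part R \<subseteq> part R'"
  unfolding part_def by (intro closure_of_mono) auto

text \<open>Both maps preserve the block number, hence the dense piece, and continuity carries this
  to the closure.\<close>

lemma part_invariant:
  assumes "w \<in> part R"
  shows "\<phi> w \<in> part R" "\<psi> w \<in> part R"
proof -
  let ?S = "e ` {y \<in> topspace X0. fst y \<in> R}"
  have c: "continuous_map W W \<phi>" "continuous_map W W \<psi>"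
    using homeomorphic_phi_psi by (auto simp: homeomorphic_maps_def)
  have pS: "point n j z \<in> ?S" if "n \<in> P" "n \<in> R" "z \<in> topspace (Z n)" for n j z
    unfolding point_def using that block_elem_mod_in by (intro imageI) auto
  have "\<phi> (e y) \<in> ?S \<and> \<psi> (e y) \<in> ?S" if "y \<in> topspace X0" "fst y \<in> R" for y
    using that(1)
  proof (cases rule: X0_cases)
    case (1 n j z)
    obtain z' where z': "z' \<in> topspace (Z n)" "z = h n z'"
      using homeomorphic_imp_surjective_map[OF homeomorphic_h[OF 1(1)]] 1(3) by blast
    \<comment> \<open>Adding \<open>p n\<close> keeps the sheet and gives the index a predecessor
      even for j = 0.\<close>
    have "point n j z = point n (Suc (j + p n - 1)) (h n z')"
      using p_pos[OF 1(1)] z' by (simp add: point_def)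
    then have "\<phi> (e y) = point n (j + p n - 1) z'"
      using phi_point[OF 1(1) z'(1)] 1(5) by simp
    moreover have "\<psi> (e y) = point n (Suc j) (h n z)"
      using psi_point 1 by simp
    ultimately show ?thesis using 1 z' h_in that(2) pS by auto
  qed
  then have "\<phi> ` ?S \<subseteq> ?S" "\<psi> ` ?S \<subseteq> ?S" by auto
  then have "\<phi> ` part R \<subseteq> part R" "\<psi> ` part R \<subseteq> part R"
    unfolding part_def using continuous_map_image_closure_subset[OF c(1), of ?S]
      continuous_map_image_closure_subset[OF c(2), of ?S] closure_of_mono by (meson order_trans)+
  then show "\<phi> w \<in> part R" "\<psi> w \<in> part R" using assms by auto
qed

lemma not_generated_by:
  assumes "Suc m \<in> P"
  shows "\<not> generated_by (space_X W) point_one nat_points (phi_X \<phi>) m"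
proof
  assume "generated_by (space_X W) point_one nat_points (phi_X \<phi>) m"
  then obtain x where x: "\<forall>i\<in>{1..m}. x i \<in> topspace W"
    and cl: "W closure_of (\<Union>i\<in>{1..m}. orbit (x i)) = topspace W"
    unfolding generated_by_iff by blast
  \<comment> \<open>Finitely many classes, so that the union of their closures is closed and covers
    W even when P is infinite; the last class collects all indices beyond m.\<close>
  define Q where "Q r = (if r \<le> m then {r} else {Suc m..})" for r
  have "e ` topspace X0 \<subseteq> (\<Union>r\<in>{1..Suc m}. part (Q r))"
  proof clarify
    fix n k z assume y: "(n, k, z) \<in> topspace X0"
    let ?r = "min n (Suc m)"
    have "n \<in> Q ?r" by (auto simp: Q_def min_def)
    then have "e (n, k, z) \<in> part (Q ?r)"
      unfolding part_def using y e_in by (intro subsetD[OF closure_of_subset]) auto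
    moreover have "?r \<in> {1..Suc m}" using y P_ge_1 by (auto simp: min_def)
    ultimately show "e (n, k, z) \<in> (\<Union>r\<in>{1..Suc m}. part (Q r))" by blast
  qed
  then have "W closure_of (e ` topspace X0) \<subseteq> (\<Union>r\<in>{1..Suc m}. part (Q r))"
    by (intro closure_of_minimal closedin_Union) (auto simp: closedin_part)
  then have "\<forall>i\<in>{1..m}. \<exists>r. r \<in> {1..Suc m} \<and> x i \<in> part (Q r)"
    using x dense_e by blast
  then obtain r where r: "\<And>i. i \<in> {1..m} \<Longrightarrow> r i \<in> {1..Suc m} \<and> x i \<in> part (Q (r i))"
    by metis
  \<comment> \<open>The m points occupy at most m of the m + 1 classes. Some class \<open>r0\<close>
    is left over, and the orbits stay in the closure of the piece over its complement.\<close>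
  have "card (r ` {1..m}) < card {1..Suc m}"
    using card_image_le[of "{1..m}" r] by simp
  then obtain r0 where r0: "r0 \<in> {1..Suc m}" "r0 \<notin> r ` {1..m}"
    by (metis card_mono finite_imageI finite_atLeastAtMost not_less subsetI)
  have orb: "orbit (x i) \<subseteq> part (- Q r0)" if i: "i \<in> {1..m}" for i
  proof (rule orbit_subset)
    have "r i \<noteq> r0" using i r0 by blast
    then have "Q (r i) \<subseteq> - Q r0" using r[OF i] r0(1) by (auto simp: Q_def split: if_splits)
    then show "x i \<in> part (- Q r0)" using r[OF i] part_mono by blast
  qed (auto simp: part_invariant)
  then have "W closure_of (\<Union>i\<in>{1..m}. orbit (x i)) \<subseteq> part (- Q r0)"
    by (intro closure_of_minimal UN_least closedin_part orb)
  moreover have "r0 \<in> P" using r0 assms P_downward_closed by auto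
  then have y: "(r0, block_elem p r0 1, pt r0) \<in> topspace X0"
    using p_pos[of r0] pt_in by (auto simp: block_def)
  moreover have "fst (r0, block_elem p r0 1, pt r0) \<notin> - Q r0" using r0 by (auto simp: Q_def)
  ultimately show False
    using cl e_in[OF y] e_notin_part[OF y, of "- Q r0"] by auto
qed

lemma n_generated_N:
  assumes "P = {1..N}"
  shows "n_generated (space_X W) point_one nat_points (phi_X \<phi>) N"
  unfolding n_generated_def
  using assms one_in_P generated_by_N[OF assms] not_generated_by by auto

lemma infinitely_generated_if:
  assumes "P = {1..}"
  shows "infinitely_generated (space_X W) point_one nat_points (phi_X \<phi>)"
  unfolding infinitely_generated_def n_generated_def using assms not_generated_by by auto

end

section \<open>The operator \<open>T\<close>\<close>

text \<open>The error bound depends on g only, so one finite Q serves all F dominated by g. This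
  gives truncations that are uniform in the time and in the points.\<close>

lemma dominated_infsum:
  fixes F :: "'a \<Rightarrow> 'k::banach"
  assumes g: "g summable_on A" and le: "\<And>n. n \<in> A \<Longrightarrow> norm (F n) \<le> g n"
  shows "F summable_on A"
    and "finite Q \<Longrightarrow> Q \<subseteq> A \<Longrightarrow> norm (infsum F A - sum F Q) \<le> infsum g A - sum g Q"
proof -
  have abs: "(\<lambda>n. norm (F n)) summable_on B" if "B \<subseteq> A" for B
    using that by (intro summable_on_comparison_test[OF summable_on_subset[OF g that]]) (auto intro: le)
  have F: "F summable_on B" if "B \<subseteq> A" for B
    by (rule abs_summable_summable[OF abs[OF that]])
  then show "F summable_on A" by simp
  assume Q: "finite Q" "Q \<subseteq> A"
  have eq: "A = Q \<union> (A - Q)" using Q by auto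
  have "infsum F A = sum F Q + infsum F (A - Q)" "infsum g A = sum g Q + infsum g (A - Q)"
    using infsum_Un_disjoint[of F Q "A - Q"] infsum_Un_disjoint[of g Q "A - Q"]
      F[of "A - Q"] summable_on_subset[OF g, of "A - Q"] Q eq by (simp_all flip: eq)
  moreover have "norm (infsum F (A - Q)) \<le> infsum g (A - Q)"
    by (rule norm_infsum_le[OF has_sum_infsum[OF F] has_sum_infsum[OF summable_on_subset[OF g]]]) (auto intro: le)
  ultimately show "norm (infsum F A - sum F Q) \<le> infsum g A - sum g Q" by simp
qed

text \<open>Real and complex scalars both have the sort of \<open>'k\<close>, so the argument is
  carried out once; \<open>banach\<close> makes absolutely convergent series converge.\<close>

locale weighted_shift_space = shift_space P p Z h pt W e \<phi>
  for P :: "nat set" and p :: "nat \<Rightarrow> nat"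
    and Z :: "nat \<Rightarrow> 'z topology" and h :: "nat \<Rightarrow> 'z \<Rightarrow> 'z" and pt :: "nat \<Rightarrow> 'z"
    and W :: "'w topology" and e :: "nat \<times> nat \<times> 'z \<Rightarrow> 'w" and \<phi> :: "'w \<Rightarrow> 'w" +
  fixes a :: "'w \<Rightarrow> 'k::{real_normed_field, banach}" and \<gamma> :: "nat \<Rightarrow> 'k"
  assumes weight: "weight_extension P p Z W e a"
    and coeffs: "admissible_coeffs P p \<gamma>"
begin

abbreviation "X \<equiv> space_X W"

abbreviation "T \<equiv> shift_T P p pt W e \<phi> a \<gamma>"

abbreviation "\<Delta> \<equiv> delta_X P p pt e \<gamma>"

lemma continuous_a: "continuous_map W euclidean a"
  and a_e: "y \<in> topspace X0 \<Longrightarrow> a (e y) = weight_X0 p y"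
  using weight by (auto simp: weight_extension_def)

text \<open>On the dense copy of X0 the weight is 1 or -1, and the condition on the norm is
  closed.\<close>

lemma norm_a:
  assumes "w \<in> topspace W"
  shows "norm (a w) = 1"
proof -
  have "continuous_map W euclideanreal (\<lambda>w. norm (a w))"
    by (intro continuous_map_norm continuous_a)
  then have "closedin W {w \<in> topspace W. norm (a w) \<in> {1}}"
    by (rule closedin_continuous_map_preimage) simp
  then have "W closure_of (e ` topspace X0) \<subseteq> {w \<in> topspace W. norm (a w) \<in> {1}}"
  proof (rule closure_of_minimal[rotated], clarify)
    fix n m z assume "(n, m, z) \<in> topspace X0"
    then show "e (n, m, z) \<in> topspace W \<and> norm (a (e (n, m, z))) \<in> {1}"
      using e_in a_e by (auto simp: weight_X0_def)
  qed
  then show ?thesis using assms dense_e by auto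
qed

lemma continuous_weight_X: "continuous_map X euclidean (weight_X a)"
  unfolding continuous_map_space_X by (auto simp: continuous_a)

lemma norm_weight_X: "x \<in> topspace X \<Longrightarrow> norm (weight_X a x) = 1"
  by (cases x) (auto simp: norm_a)

text \<open>The total mass that \<Delta> puts on the n-th block; it dominates the n-th summand for
  every f bounded by 1.\<close>

definition mass :: "nat \<Rightarrow> real" where
  "mass n = (\<Sum>m\<in>block p n. norm (\<gamma> m))"

lemma coeff_index_eq: "coeff_index P p = (\<Union>n\<in>P. block p n)"
proof (cases "P = {1..}")
  case True
  have "m \<in> (\<Union>n\<in>P. block p n)" if "1 \<le> m" for m
  proof -
    \<comment> \<open>Every \<open>p n\<close> is at least 1, so the first m blocks reach up to
      m.\<close>
    have "(\<Sum>n=1..m. 1) \<le> (\<Sum>n=1..m. p n)"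
      using p_pos True by (intro sum_mono) force
    then have "m \<in> {1..\<Sum>n=1..m. p n}" using that by simp
    then show ?thesis
      unfolding atLeastAtMost_sum_eq_Union_block using True by auto
  qed
  moreover have "1 \<le> m" if "m \<in> block p n" for m n
    using that by (auto simp: block_def block_elem_def)
  ultimately have "{1..} = (\<Union>n\<in>P. block p n)" by auto
  then show ?thesis using True by (simp add: coeff_index_def)
next
  case False
  then obtain N where "P = {1..N}" using initial by (auto simp: initial_index_set_def)
  then show ?thesis
    using False atLeastAtMost_sum_eq_Union_block[of p N] by (simp add: coeff_index_def)
qed

lemma coeff_index_eq_image: "coeff_index P p = snd ` Sigma P (block p)"
  unfolding coeff_index_eq by (auto simp: image_iff)

text \<open>The blocks are disjoint, so a sum over N_0 is a sum over pairs (n, m), which can be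
  grouped by n.\<close>

lemma inj_on_snd_blocks: "inj_on snd (Sigma P (block p))"
proof (rule inj_onI, clarsimp)
  fix n n' m assume "n \<in> P" "m \<in> block p n" "n' \<in> P" "m \<in> block p n'"
  then show "n = n'"
    using block_less[of n n' m p m] block_less[of n' n m p m] P_ge_1 by (meson less_irrefl nat_neq_iff)
qed

lemma summable_mass: "mass summable_on P" and infsum_mass: "infsum mass P \<le> 1"
proof -
  let ?s = "\<Sum>\<^sub>\<infinity>m\<in>coeff_index P p. norm (\<gamma> m)"
  have "((\<lambda>m. norm (\<gamma> m)) has_sum ?s) (coeff_index P p)"
    using coeffs by (auto simp: admissible_coeffs_def)
  then have "((\<lambda>x. norm (\<gamma> (snd x))) has_sum ?s) (Sigma P (block p))"
    using inj_on_snd_blocks by (simp add: coeff_index_eq_image has_sum_reindex o_def)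
  then have "(mass has_sum ?s) P"
    by (rule has_sum_SigmaD) (simp add: mass_def has_sum_finiteI)
  then show "mass summable_on P" "infsum mass P \<le> 1"
    using coeffs by (auto simp: admissible_coeffs_def has_sum_iff)
qed

definition delta_term :: "('w + nat option \<Rightarrow> 'k) \<Rightarrow> nat \<Rightarrow> 'k" where
  "delta_term f n = (\<Sum>m\<in>block p n. \<gamma> m * f (Inl (e (n, m, pt n))))"

lemma delta_X_eq: "\<Delta> f = infsum (delta_term f) P"
  by (simp add: delta_X_def delta_term_def[abs_def])

lemma norm_delta_term:
  assumes "\<And>x. norm (f x) \<le> B"
  shows "norm (delta_term f n) \<le> B * mass n"
  unfolding delta_term_def mass_def sum_distrib_left
proof (rule sum_norm_le)
  fix m
  have "norm (\<gamma> m * f (Inl (e (n, m, pt n)))) = norm (f (Inl (e (n, m, pt n)))) * norm (\<gamma> m)"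
    by (simp add: norm_mult)
  also have "\<dots> \<le> B * norm (\<gamma> m)" by (intro mult_right_mono assms norm_ge_zero)
  finally show "norm (\<gamma> m * f (Inl (e (n, m, pt n)))) \<le> B * norm (\<gamma> m)" .
qed

lemma cspace_boundE:
  assumes "f \<in> cspace X"
  obtains B where "\<And>x. norm (f x) \<le> B" "0 < B"
proof -
  obtain B where B: "\<And>x. norm (f x) \<le> B" using cspace_bounded[OF compact_W assms] by blast
  show ?thesis
    by (rule that[of "max B 1"]) (auto intro: order_trans[OF B])
qed

lemma summable_delta_term:
  assumes "f \<in> cspace X"
  shows "delta_term f summable_on P"
proof -
  obtain B where B: "\<And>x. norm (f x) \<le> B" using cspace_boundE[OF assms] by metis
  show ?thesis
    using norm_delta_term[of f, OF B]
    by (rule dominated_infsum(1)[OF summable_on_cmult_right[OF summable_mass]])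
qed

lemma norm_delta_X:
  assumes "\<And>x. norm (f x) \<le> B"
  shows "norm (\<Delta> f) \<le> B"
proof -
  have "0 \<le> B" using assms norm_ge_zero order_trans by blast
  \<comment> \<open>Truncation to the empty set turns the tail estimate into a bound on the whole
    sum.\<close>
  have "norm (infsum (delta_term f) P - sum (delta_term f) {}) \<le> infsum (\<lambda>n. B * mass n) P - sum (\<lambda>n. B * mass n) {}"
    by (rule dominated_infsum(2)[OF summable_on_cmult_right[OF summable_mass] norm_delta_term[of f, OF assms]]) auto
  also have "\<dots> = B * infsum mass P"
    by (simp add: infsum_cmult_right')
  also have "\<dots> \<le> B" using infsum_mass \<open>0 \<le> B\<close> by (simp add: mult_left_le)
  finally show ?thesis by (simp add: delta_X_eq)
qed

section \<open>T as an isometry with range of codimension 1\<close>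

lemma T_outside: "x \<notin> topspace X \<Longrightarrow> T f x = 0"
  and T_point_one: "T f point_one = \<Delta> f"
  and T_off_point_one: "x \<in> topspace X - {point_one} \<Longrightarrow> T f x = weight_X a x * f (phi_X \<phi> x)"
  by (auto simp: shift_T_def shift_op_def)

lemma T_Inl: "w \<in> topspace W \<Longrightarrow> T f (Inl w) = a w * f (Inl (\<phi> w))"
  by (simp add: T_off_point_one)

lemma T_Suc: "1 \<le> n \<Longrightarrow> T f (Inr (Some (Suc n))) = f (Inr (Some n))"
  by (subst T_off_point_one) (auto simp: point_one_def)

lemma phi_X_in: "x \<in> topspace X - {point_one} \<Longrightarrow> phi_X \<phi> x \<in> topspace X"
  and psi_X_in: "x \<in> topspace X \<Longrightarrow> psi_X \<psi> x \<in> topspace X - {point_one}"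
  and phi_psi_X: "x \<in> topspace X \<Longrightarrow> phi_X \<phi> (psi_X \<psi> x) = x"
  and psi_phi_X: "x \<in> topspace X - {point_one} \<Longrightarrow> psi_X \<psi> (phi_X \<phi> x) = x"
  and continuous_phi_X: "continuous_map (subtopology X (topspace X - {point_one})) X (phi_X \<phi>)"
  and continuous_psi_X: "continuous_map X X (psi_X \<psi>)"
proof -
  let ?X' = "subtopology X (topspace X - {point_one})"
  have top: "topspace ?X' = topspace X - {point_one}" by (simp add: Int_absorb1)
  have c: "continuous_map ?X' X (phi_X \<phi>)" "continuous_map X ?X' (psi_X \<psi>)"
    and inv: "\<forall>x\<in>topspace ?X'. psi_X \<psi> (phi_X \<phi> x) = x" "\<forall>x\<in>topspace X. phi_X \<phi> (psi_X \<psi> x) = x"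
    using homeomorphic_maps_phi_X[OF homeomorphic_phi_psi] unfolding homeomorphic_maps_def by blast+
  show "x \<in> topspace X - {point_one} \<Longrightarrow> phi_X \<phi> x \<in> topspace X"
    using continuous_map_funspace[OF c(1)] unfolding top by blast
  show "x \<in> topspace X \<Longrightarrow> psi_X \<psi> x \<in> topspace X - {point_one}"
    using continuous_map_funspace[OF c(2)] unfolding top by blast
  show "x \<in> topspace X \<Longrightarrow> phi_X \<phi> (psi_X \<psi> x) = x"
    using inv(2) by blast
  show "x \<in> topspace X - {point_one} \<Longrightarrow> psi_X \<psi> (phi_X \<phi> x) = x"
    using inv(1) unfolding top by blast
  show "continuous_map ?X' X (phi_X \<phi>)" by (rule c(1))
  show "continuous_map X X (psi_X \<psi>)" using c(2) by (rule continuous_map_into_fulltopology)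
qed

lemma T_in_cspace:
  assumes "f \<in> cspace X"
  shows "T f \<in> cspace X"
proof -
  have "continuous_map (subtopology X (topspace X - {point_one})) euclidean
      (\<lambda>x. weight_X a x * (f \<circ> phi_X \<phi>) x)"
    using assms by (intro continuous_map_mult_field continuous_map_compose[OF continuous_phi_X]
        continuous_map_from_subtopology continuous_weight_X) (auto simp: cspace_def)
  then have "continuous_map (subtopology X (topspace X - {point_one})) euclidean (T f)"
    by (rule continuous_map_eq) (simp add: T_off_point_one)
  then have "continuous_map X euclidean (T f)"
    by (rule continuous_map_space_X_Diff_point_one) simp
  then show ?thesis by (simp add: cspace_def T_outside)
qed

text \<open>The new value \<Delta> f at the point 1 does not exceed the norm of f because the
  coefficients have total mass at most 1. Off this point |T f| takes exactly the values of |f|,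
  since \<open>phi_X\<close> is onto.\<close>

lemma sup_norm_T:
  assumes f: "f \<in> cspace X"
  shows "sup_norm X (T f) = sup_norm X f"
proof (rule antisym)
  have ne: "topspace X \<noteq> {}" using point_one_in_space_X by blast
  have bdd: "bdd_above ((\<lambda>x. norm (g x)) ` topspace X)" if g: "g \<in> cspace X" for g :: "_ \<Rightarrow> 'k"
    by (rule cspace_boundE[OF g]) (auto intro!: bdd_aboveI2)
  have ub: "norm (g x) \<le> sup_norm X g" if "g \<in> cspace X" "x \<in> topspace X" for g :: "_ \<Rightarrow> 'k" and x
    unfolding sup_norm_def by (rule cSUP_upper[OF that(2) bdd[OF that(1)]])
  have "0 \<le> sup_norm X f"
    using ub[OF f point_one_in_space_X] norm_ge_zero order_trans by blast
  then have "norm (f x) \<le> sup_norm X f" for x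
    using ub[OF f] f by (cases "x \<in> topspace X") (auto simp: cspace_def)
  then have one: "norm (\<Delta> f) \<le> sup_norm X f" by (rule norm_delta_X)
  have "norm (T f x) \<le> sup_norm X f" if x: "x \<in> topspace X" for x
    using one ub[OF f phi_X_in[of x]] x
    by (cases "x = point_one") (auto simp: T_point_one T_off_point_one norm_mult norm_weight_X)
  then show "sup_norm X (T f) \<le> sup_norm X f"
    unfolding sup_norm_def[of X "T f"] by (intro cSUP_least[OF ne])
  have "norm (f x) \<le> sup_norm X (T f)" if x: "x \<in> topspace X" for x
    using ub[OF T_in_cspace[OF f], of "psi_X \<psi> x"] psi_X_in[OF x] phi_psi_X[OF x]
    by (simp add: T_off_point_one norm_mult norm_weight_X)
  then show "sup_norm X f \<le> sup_norm X (T f)"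
    unfolding sup_norm_def[of X f] by (intro cSUP_least[OF ne])
qed

lemma linear_isometry_T: "linear_isometry X T"
  unfolding linear_isometry_def
proof (intro conjI ballI allI)
  show "T ` cspace X \<subseteq> cspace X" using T_in_cspace by blast
  fix f :: "'w + nat option \<Rightarrow> 'k" assume f: "f \<in> cspace X"
  show "sup_norm X (T f) = sup_norm X f" by (rule sup_norm_T[OF f])
  show "T (\<lambda>x. c * f x) = (\<lambda>x. c * T f x)" for c
  proof -
    have "delta_term (\<lambda>x. c * f x) = (\<lambda>n. c * delta_term f n)"
      by (simp add: fun_eq_iff delta_term_def sum_distrib_left mult.left_commute)
    then have "\<Delta> (\<lambda>x. c * f x) = c * \<Delta> f"
      unfolding delta_X_eq by (simp only: infsum_cmult_right')
    then show ?thesis by (auto simp: shift_T_def shift_op_def fun_eq_iff)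
  qed
  fix g :: "'w + nat option \<Rightarrow> 'k" assume g: "g \<in> cspace X"
  show "T (\<lambda>x. f x + g x) = (\<lambda>x. T f x + T g x)"
  proof -
    have "delta_term (\<lambda>x. f x + g x) = (\<lambda>n. delta_term f n + delta_term g n)"
      by (simp add: fun_eq_iff delta_term_def sum.distrib distrib_left)
    then have "\<Delta> (\<lambda>x. f x + g x) = \<Delta> f + \<Delta> g"
      unfolding delta_X_eq by (simp only: infsum_add summable_delta_term f g)
    then show ?thesis by (auto simp: shift_T_def shift_op_def fun_eq_iff distrib_left)
  qed
qed

text \<open>The solution is f divided by the weight, composed with the inverse homeomorphism; T g at
  the point 1 is then determined and may differ from f there.\<close>

lemma T_surj_off_point_one:
  assumes f: "f \<in> cspace X"
  obtains g where "g \<in> cspace X" "\<And>x. x \<noteq> point_one \<Longrightarrow> T g x = f x"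
proof -
  define g where "g x = (if x \<in> topspace X then inverse (weight_X a (psi_X \<psi> x)) * f (psi_X \<psi> x) else 0)" for x
  have nz: "weight_X a x \<noteq> 0" if "x \<in> topspace X" for x
    using norm_weight_X[OF that] by auto
  have "continuous_map X euclidean (\<lambda>x. inverse ((weight_X a \<circ> psi_X \<psi>) x) * (f \<circ> psi_X \<psi>) x)"
    using f psi_X_in nz
    by (intro continuous_map_mult_field continuous_map_inverse_field continuous_map_compose[OF continuous_psi_X]
        continuous_weight_X) (auto simp: cspace_def)
  then have "continuous_map X euclidean g"
    by (rule continuous_map_eq) (simp add: g_def)
  then have "g \<in> cspace X" by (simp add: cspace_def g_def)
  moreover have "T g x = f x" if "x \<noteq> point_one" for x
    using f nz[of x] phi_X_in[of x] psi_phi_X[of x] that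
    by (cases "x \<in> topspace X") (auto simp: T_outside T_off_point_one g_def cspace_def)
  ultimately show ?thesis by (rule that)
qed

text \<open>The indicator function of the point 1 spans a complement. It is not in the range: a
  preimage would vanish on W, where \<Delta> is concentrated, so its image would vanish at 1
  too.\<close>

lemma codimension_one_T: "codimension_one (T ` cspace X) (cspace X)"
  unfolding codimension_one_def
proof (intro conjI)
  show "T ` cspace X \<subseteq> cspace X" using T_in_cspace by blast
  define u :: "'w + nat option \<Rightarrow> 'k" where "u x = (if x = point_one then 1 else 0)" for x
  have "continuous_map (subtopology X (topspace X - {point_one})) euclidean (\<lambda>x. 0 :: 'k)" by simp
  then have "continuous_map (subtopology X (topspace X - {point_one})) euclidean u"
    by (rule continuous_map_eq) (simp add: u_def)
  then have "continuous_map X euclidean u"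
    by (rule continuous_map_space_X_Diff_point_one) simp
  then have u: "u \<in> cspace X" by (auto simp: cspace_def u_def)
  have "u \<notin> T ` cspace X"
  proof
    assume "u \<in> T ` cspace X"
    then obtain f where f: "f \<in> cspace X" "u = T f" by auto
    have "f (Inl w) = 0" if w: "w \<in> topspace W" for w
    proof -
      have "T f (Inl (\<psi> w)) = 0" using f(2) by (metis Inl_neq_point_one u_def)
      then show ?thesis
        using T_Inl[OF psi_in[OF w], of f] phi_psi[OF w] norm_a[OF psi_in[OF w]] by auto
    qed
    then have "delta_term f n = 0" if "n \<in> P" for n
      unfolding delta_term_def using that e_in pt_in by (intro sum.neutral) auto
    then have "\<Delta> f = 0" unfolding delta_X_eq by (intro infsum_0) auto
    then show False using fun_cong[OF f(2), of point_one] T_point_one[of f] by (simp add: u_def)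
  qed
  moreover have "\<exists>c. \<exists>g\<in>T ` cspace X. f = (\<lambda>x. c * u x + g x)" if f: "f \<in> cspace X" for f
  proof -
    obtain g where g: "g \<in> cspace X" "\<And>x. x \<noteq> point_one \<Longrightarrow> T g x = f x"
      by (rule T_surj_off_point_one[OF f]) (rule that)
    have "f = (\<lambda>x. (f point_one - T g point_one) * u x + T g x)"
      using g(2) by (auto simp: u_def fun_eq_iff)
    then show ?thesis using g(1) by blast
  qed
  ultimately show "\<exists>u\<in>cspace X. u \<notin> T ` cspace X \<and>
      (\<forall>f\<in>cspace X. \<exists>c. \<exists>g\<in>T ` cspace X. f = (\<lambda>x. c * u x + g x))"
    using u by blast
qed

section \<open>Antiperiodic coordinates and the summands of Delta\<close>

text \<open>\<open>f\<close> on \<open>A\<^sub>n \<times> {z}\<close>, extended antiperiodically to all indices: the sign that \<open>T\<close> introduces when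
  passing through \<open>a\<^sub>1\<close> is absorbed, so that \<open>T\<close> acts as a translation.\<close>

definition coord :: "('w + nat option \<Rightarrow> 'k) \<Rightarrow> nat \<Rightarrow> nat \<Rightarrow> 'z \<Rightarrow> 'k" where
  "coord f n j z = (- 1) ^ (j div p n) * f (Inl (point n j z))"

lemma norm_coord: "norm (coord f n j z) = norm (f (Inl (point n j z)))"
  by (simp add: coord_def norm_mult norm_power)

lemma coord_antiperiodic:
  assumes "n \<in> P"
  shows "coord f n (j + p n) z = - coord f n j z"
  using p_pos[OF assms] by (simp add: coord_def point_def)

lemma a_point:
  assumes "n \<in> P" "z \<in> topspace (Z n)"
  shows "a (point n j z) = (if j mod p n = 0 then - 1 else 1)"
  using assms a_e[of "(n, block_elem p n (j mod p n + 1), z)"] block_elem_mod_in[of n j]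
  by (auto simp: point_def weight_X0_def)

lemma coord_T:
  assumes n: "n \<in> P" and z: "z \<in> topspace (Z n)"
  shows "coord (T f) n (Suc j) (h n z) = coord f n j z"
proof -
  have "T f (Inl (point n (Suc j) (h n z))) =
      (if Suc j mod p n = 0 then - 1 else 1) * f (Inl (point n j z))"
    using T_Inl[OF point_in[OF n h_in[OF n z]]] a_point[OF n h_in[OF n z]] phi_point[OF n z] by simp
  then show ?thesis by (simp add: coord_def div_Suc)
qed

lemma coord_funpow_T:
  assumes n: "n \<in> P" and z: "z \<in> topspace (Z n)"
  shows "coord ((T ^^ k) f) n (j + k) ((h n ^^ k) z) = coord f n j z"
proof (induction k)
  case (Suc k)
  then show ?case
    using coord_T[OF n funpow_h_in[OF n z], of "(T ^^ k) f" "j + k" k] by simp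
qed simp

text \<open>At k = 0 and z = \<open>pt n\<close> this is the n-th summand of \<Delta>. In general it
  is, up to sign, row \<open>k mod p n\<close> of the coefficient matrix applied to the coordinates
  of f over z.\<close>

definition D :: "('w + nat option \<Rightarrow> 'k) \<Rightarrow> nat \<Rightarrow> nat \<Rightarrow> 'z \<Rightarrow> 'k" where
  "D f n k z = (\<Sum>j<p n. \<gamma> (block_elem p n (j + 1)) * coord f n (j + k) z)"

lemma D_antiperiodic: "n \<in> P \<Longrightarrow> D f n (k + p n) z = - D f n k z"
  using coord_antiperiodic[of n f "_ + k" z] by (simp add: D_def sum_negf flip: add.assoc)

text \<open>Taking q = \<open>p N\<close> makes \<open>2 * p N\<close> a common period for all n up
  to N.\<close>

lemma D_periodic:
  assumes "n \<in> P" "p n dvd q"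
  shows "D f n (k + 2 * q * t) z = D f n k z"
proof -
  obtain c where "q = p n * c" using assms by (auto elim: dvdE)
  then have eq: "k + 2 * q * t = k + 2 * p n * (c * t)" by simp
  show ?thesis
    unfolding eq using D_antiperiodic[OF assms(1), of f _ z] by (rule antiperiodic_even_multiple)
qed

lemma p_dvd: "1 \<le> m \<Longrightarrow> m \<le> n \<Longrightarrow> n \<in> P \<Longrightarrow> p m dvd p n"
  using double_p_dvd[of m n] by (cases "m = n") (auto elim: dvd_mult_right)

lemma norm_D:
  assumes "\<And>x. norm (f x) \<le> B"
  shows "norm (D f n k z) \<le> B * mass n"
  unfolding D_def mass_def sum_block sum_distrib_left
proof (rule sum_norm_le)
  fix j
  have "norm (\<gamma> (block_elem p n (j + 1)) * coord f n (j + k) z)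
      = norm (f (Inl (point n (j + k) z))) * norm (\<gamma> (block_elem p n (j + 1)))"
    by (simp add: norm_mult norm_coord)
  also have "\<dots> \<le> B * norm (\<gamma> (block_elem p n (j + 1)))"
    by (intro mult_right_mono assms norm_ge_zero)
  finally show "norm (\<gamma> (block_elem p n (j + 1)) * coord f n (j + k) z)
      \<le> B * norm (\<gamma> (block_elem p n (j + 1)))" .
qed

lemma continuous_D:
  assumes f: "f \<in> cspace X" and n: "n \<in> P"
  shows "continuous_map (Z n) euclidean (D f n k)"
proof -
  have fc: "continuous_map W euclidean (\<lambda>w. f (Inl w))"
    using f continuous_map_space_X[of W euclidean f] unfolding cspace_def by blast
  have "continuous_map (Z n) euclidean (coord f n j)" for j
  proof -
    have "continuous_map (Z n) W (point n j)"
      unfolding point_def[abs_def] by (intro continuous_e_slice n block_elem_mod_in)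
    from continuous_map_compose[OF this fc]
    show ?thesis unfolding coord_def[abs_def]
      by (intro continuous_map_mult_field) (auto simp: o_def)
  qed
  then show ?thesis
    unfolding D_def[abs_def] by (intro continuous_map_sum continuous_map_mult_field) auto
qed

text \<open>Moving the index and the point along undoes the k-fold translation, so the summands of
  \<Delta> f are recovered from T^k f.\<close>

lemma delta_term_eq_D:
  assumes n: "n \<in> P"
  shows "delta_term f n = D ((T ^^ k) f) n k ((h n ^^ k) (pt n))"
  using coord_funpow_T[OF n pt_in[OF n], of k f]
  by (auto simp: delta_term_def D_def sum_block coord_def point_def intro!: sum.cong)

section \<open>Functions in the intersection of the ranges\<close>

lemma funpow_T_Suc: "(T ^^ k) f (Inr (Some (Suc k))) = f point_one"
  by (induction k) (simp_all add: T_Suc point_one_def)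

text \<open>The first application of T places \<Delta> f at the point 1, and the other k - 1 carry
  it to k. The right-hand side refers to T^k f only, so a function in all the ranges satisfies this
  identity for every k, whatever its preimages are.\<close>

lemma funpow_T_at_nat:
  assumes "1 \<le> k"
  shows "(T ^^ k) f (Inr (Some k)) = (\<Sum>\<^sub>\<infinity>n\<in>P. D ((T ^^ k) f) n k ((h n ^^ k) (pt n)))"
proof -
  obtain l where k: "k = Suc l" using assms by (cases k) auto
  have "(T ^^ k) f (Inr (Some k)) = T f point_one"
    using funpow_T_Suc[of l "T f"] by (simp add: k funpow_swap1)
  also have "\<dots> = infsum (delta_term f) P" by (simp add: T_point_one delta_X_eq)
  also have "\<dots> = (\<Sum>\<^sub>\<infinity>n\<in>P. D ((T ^^ k) f) n k ((h n ^^ k) (pt n)))"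
    by (intro infsum_cong delta_term_eq_D)
  finally show ?thesis .
qed

text \<open>The threshold k0 does not depend on i. The application relies on this: there i is chosen
  after a whole window of indices k.\<close>

lemma truncated_limit:
  assumes f: "f \<in> cspace X"
    and at_nat: "\<And>k. 1 \<le> k \<Longrightarrow> f (Inr (Some k)) = (\<Sum>\<^sub>\<infinity>n\<in>P. D f n k ((h n ^^ k) (pt n)))"
    and m: "m \<in> P" and \<epsilon>: "0 < \<epsilon>"
  obtains N k0 where "N \<in> P" "m \<le> N"
    "\<And>k i. k0 \<le> k \<Longrightarrow> k < i \<Longrightarrow> norm ((\<Sum>n=1..N. D f n k ((h n ^^ i) (pt n))) - f (Inr None)) \<le> \<epsilon>"
proof -
  let ?L = "f (Inr None)"
  obtain B where B: "\<And>x. norm (f x) \<le> B" "0 < B" by (rule cspace_boundE[OF f]) (rule that)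
  have sg: "(\<lambda>n. B * mass n) summable_on P"
    by (intro summable_on_cmult_right summable_mass)
  obtain Q where Q: "finite Q" "Q \<subseteq> P"
    "dist (\<Sum>n\<in>Q. B * mass n) (\<Sum>\<^sub>\<infinity>n\<in>P. B * mass n) \<le> \<epsilon> / 2"
    using infsum_finite_approximation[OF sg, of "\<epsilon> / 2"] \<epsilon> by auto
  \<comment> \<open>N has to lie in P, as transitivity is applied with exponent
    \<open>2 * p N\<close>; including m and Q makes it large enough.\<close>
  define N where "N = Max (insert m Q)"
  have N: "N \<in> P" "m \<le> N" "Q \<subseteq> {1..N}"
  proof -
    have "N \<in> insert m Q" unfolding N_def by (intro Max_in) (use Q in auto)
    then show "N \<in> P" using m Q by auto
    show "m \<le> N" unfolding N_def by (intro Max_ge) (use Q in auto)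
    show "Q \<subseteq> {1..N}"
      using Q P_ge_1 by (auto simp: N_def)
  qed
  have NP: "n \<in> P" if "n \<in> {1..N}" for n
    using P_downward_closed[OF N(1)] that by simp
  \<comment> \<open>\<open>B * mass n\<close> bounds the n-th term for every index and every point,
    so the same N works for all k.\<close>
  have tail: "norm ((\<Sum>\<^sub>\<infinity>n\<in>P. D f n k (z n)) - (\<Sum>n=1..N. D f n k (z n))) \<le> \<epsilon> / 2" for k z
  proof -
    have "norm ((\<Sum>\<^sub>\<infinity>n\<in>P. D f n k (z n)) - (\<Sum>n=1..N. D f n k (z n)))
        \<le> (\<Sum>\<^sub>\<infinity>n\<in>P. B * mass n) - (\<Sum>n=1..N. B * mass n)"
      using NP by (intro dominated_infsum(2)[OF sg]) (auto intro: norm_D B)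
    also have "\<dots> \<le> (\<Sum>\<^sub>\<infinity>n\<in>P. B * mass n) - (\<Sum>n\<in>Q. B * mass n)"
      using N(3) B(2)
      by (intro diff_left_mono sum_mono2) (auto simp: mass_def intro!: mult_nonneg_nonneg sum_nonneg)
    also have "\<dots> \<le> \<epsilon> / 2"
      using Q(3) unfolding dist_real_def abs_le_iff by linarith
    finally show ?thesis .
  qed
  have "continuous_map X euclidean f" using f by (simp add: cspace_def)
  moreover have "openin euclidean (ball ?L (\<epsilon> / 2))" "?L \<in> ball ?L (\<epsilon> / 2)"
    using \<epsilon> by simp_all
  ultimately have "finite {n. 1 \<le> n \<and> f (Inr (Some n)) \<notin> ball ?L (\<epsilon> / 2)}"
    unfolding continuous_map_space_X by blast
  then obtain l where l: "\<And>n. n \<in> {n. 1 \<le> n \<and> f (Inr (Some n)) \<notin> ball ?L (\<epsilon> / 2)} \<Longrightarrow> n < l"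
    unfolding finite_nat_set_iff_bounded by blast
  have diag: "norm ((\<Sum>n=1..N. D f n k ((h n ^^ k) (pt n))) - ?L) \<le> \<epsilon>" if k: "max 1 l \<le> k" for k
  proof -
    have "f (Inr (Some k)) \<in> ball ?L (\<epsilon> / 2)" using l[of k] k by auto
    then have "norm (f (Inr (Some k)) - ?L) \<le> \<epsilon> / 2"
      by (simp add: dist_norm norm_minus_commute)
    moreover have "norm (f (Inr (Some k)) - (\<Sum>n=1..N. D f n k ((h n ^^ k) (pt n)))) \<le> \<epsilon> / 2"
      using at_nat[of k] tail[of k "\<lambda>n. (h n ^^ k) (pt n)"] k by simp
    ultimately have "norm ((f (Inr (Some k)) - ?L) -
        (f (Inr (Some k)) - (\<Sum>n=1..N. D f n k ((h n ^^ k) (pt n))))) \<le> \<epsilon> / 2 + \<epsilon> / 2"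
      by (rule norm_triangle_le_diff[OF add_mono])
    then show ?thesis by simp
  qed
  show ?thesis
  proof (rule that[OF N(1,2)])
    fix k i assume k: "max 1 l \<le> k" and i: "k < i"
    let ?Y = "product_topology Z P"
    \<comment> \<open>Only the points vary, the index k stays fixed; the estimate becomes a closed
      condition on the product.\<close>
    define G where "G y = norm ((\<Sum>n=1..N. D f n k ((h n ^^ k) (y n))) - ?L)" for y
    have "continuous_map ?Y euclidean (\<lambda>y. D f n k ((h n ^^ k) (y n)))" if n: "n \<in> {1..N}" for n
    proof -
      have "continuous_map ?Y (Z n) (\<lambda>y. y n)"
        by (rule continuous_map_product_projection[OF NP[OF n]])
      from continuous_map_compose[OF continuous_map_compose[OF this continuous_funpow_h[OF NP[OF n]]]
          continuous_D[OF f NP[OF n]]]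
      show ?thesis by (simp add: o_def)
    qed
    then have "continuous_map ?Y euclideanreal G"
      unfolding G_def[abs_def]
      by (intro continuous_map_norm continuous_map_diff continuous_map_sum) auto
    then have closed: "closedin ?Y {y \<in> topspace ?Y. G y \<in> {..\<epsilon>}}"
      by (rule closedin_continuous_map_preimage) simp
    let ?S = "{(\<lambda>n\<in>P. (h n ^^ (2 * p N * t)) (pt n)) | t. 1 \<le> t}"
    have "?S \<subseteq> {y \<in> topspace ?Y. G y \<in> {..\<epsilon>}}"
    proof clarify
      fix t :: nat
      let ?y = "\<lambda>n\<in>P. (h n ^^ (2 * p N * t)) (pt n)"
      \<comment> \<open>A jump of \<open>2 * p N * t\<close> in the index changes nothing for n up
        to N, so at this tuple G is the diagonal quantity at time
        \<open>k + 2 * p N * t\<close>.\<close>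
      have "D f n k ((h n ^^ k) (?y n)) = D f n (k + 2 * p N * t) ((h n ^^ (k + 2 * p N * t)) (pt n))"
        if n: "n \<in> {1..N}" for n
        using D_periodic[OF NP[OF n] p_dvd[OF _ _ N(1)]] NP[OF n] n by (simp add: funpow_add)
      then have "G ?y = norm ((\<Sum>n=1..N. D f n (k + 2 * p N * t) ((h n ^^ (k + 2 * p N * t)) (pt n))) - ?L)"
        unfolding G_def by simp
      then have "G ?y \<le> \<epsilon>" using diag[of "k + 2 * p N * t"] k by simp
      moreover have "?y \<in> topspace ?Y" using funpow_h_in pt_in by auto
      ultimately show "?y \<in> topspace ?Y \<and> G ?y \<in> {..\<epsilon>}" by simp
    qed
    then have "?Y closure_of ?S \<subseteq> {y \<in> topspace ?Y. G y \<in> {..\<epsilon>}}"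
      using closed by (rule closure_of_minimal)
    \<comment> \<open>The strict inequality k < i is due to transitivity, which speaks of exponents
      from 1 on.\<close>
    moreover have "1 \<le> i - k" using i by simp
    then have "(\<lambda>n\<in>P. (h n ^^ (i - k)) (pt n)) \<in> ?Y closure_of ?S"
      using transitive N(1) unfolding transitive_family_def by blast
    ultimately have "G (\<lambda>n\<in>P. (h n ^^ (i - k)) (pt n)) \<le> \<epsilon>" by blast
    moreover have "(h n ^^ k) ((\<lambda>n\<in>P. (h n ^^ (i - k)) (pt n)) n) = (h n ^^ i) (pt n)"
      if "n \<in> {1..N}" for n
    proof -
      have "(h n ^^ k) ((h n ^^ (i - k)) (pt n)) = (h n ^^ (k + (i - k))) (pt n)"
        by (simp only: funpow_add o_apply)
      then show ?thesis using NP[OF that] i by simp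
    qed
    ultimately show "norm ((\<Sum>n=1..N. D f n k ((h n ^^ i) (pt n))) - ?L) \<le> \<epsilon>"
      by (simp add: G_def)
  qed
qed

lemma D_eq_0:
  assumes f: "f \<in> cspace X"
    and at_nat: "\<And>k. 1 \<le> k \<Longrightarrow> f (Inr (Some k)) = (\<Sum>\<^sub>\<infinity>n\<in>P. D f n k ((h n ^^ k) (pt n)))"
    and m: "m \<in> P" and z: "z \<in> topspace (Z m)"
  shows "D f m k z = 0"
proof -
  have "norm (D f m k z) \<le> \<epsilon>" if \<epsilon>: "0 < \<epsilon>" for \<epsilon>
  proof -
    obtain N k0 where N: "N \<in> P" "m \<le> N"
      and le: "\<And>k i. k0 \<le> k \<Longrightarrow> k < i \<Longrightarrow>
        norm ((\<Sum>n=1..N. D f n k ((h n ^^ i) (pt n))) - f (Inr None)) \<le> \<epsilon>"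
      by (rule truncated_limit[OF f _ m \<epsilon>]) (erule at_nat, rule that)
    have NP: "n \<in> P" if "n \<in> {1..N}" for n
      using P_downward_closed[OF N(1)] that by simp
    \<comment> \<open>An index beyond k0, which depends on \<epsilon>, at which the m-th term is the
      same as at k.\<close>
    define k1 where "k1 = k + 2 * p m * k0"
    have "k0 \<le> 2 * p m * k0" using p_pos[OF m] by simp
    then have k1: "k0 \<le> k1" unfolding k1_def by (rule trans_le_add2)
    \<comment> \<open>The point stays at the iterate i while the index runs through the averaging
      window; i has to exceed the whole window for \<open>le\<close> to apply.\<close>
    have bound: "norm (D f m k1 ((h m ^^ i) (pt m))) \<le> \<epsilon>"
      if i: "k1 + 2 * p m * p N + p m < i" for i
    proof (rule norm_antiperiodic_component_le[where d = "\<lambda>n k. D f n k ((h n ^^ i) (pt n))" and N = N and p = p])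
      show "D f n (k + p n) ((h n ^^ i) (pt n)) = - D f n k ((h n ^^ i) (pt n))" if "n \<in> {1..N}" for n k
        using NP[OF that] by (rule D_antiperiodic)
      show "2 * p m dvd p n \<and> p n dvd p N" if "n \<in> {m<..N}" for n
        using that P_ge_1[OF m] NP[of n] N double_p_dvd p_dvd by auto
      show "2 * p n dvd p m" if "n \<in> {1..<m}" for n
        using that m double_p_dvd by auto
      show "norm ((\<Sum>n=1..N. D f n k' ((h n ^^ i) (pt n))) - f (Inr None)) \<le> \<epsilon>"
        if "k1 \<le> k'" "k' \<le> k1 + 2 * p m * p N + p m" for k'
        using le that i k1 by simp
    qed (use P_ge_1[OF m] N p_pos m in auto)
    let ?l = "k1 + 2 * p m * p N + p m"
    have "continuous_map (Z m) euclideanreal (\<lambda>z. norm (D f m k1 z))"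
      by (intro continuous_map_norm continuous_D f m)
    then have "closedin (Z m) {z \<in> topspace (Z m). norm (D f m k1 z) \<in> {..\<epsilon>}}"
      by (rule closedin_continuous_map_preimage) simp
    \<comment> \<open>Only large i are available, but the tail of the orbit is still dense, so the
      bound spreads to all z.\<close>
    then have "Z m closure_of {(h m ^^ i) (pt m) | i. ?l < i}
        \<subseteq> {z \<in> topspace (Z m). norm (D f m k1 z) \<in> {..\<epsilon>}}"
      by (rule closure_of_minimal[rotated]) (use bound funpow_h_in[OF m pt_in[OF m]] in auto)
    then have "norm (D f m k1 z) \<le> \<epsilon>"
      using dense_orbit_tail[OF m] z by auto
    then show ?thesis
      using D_periodic[OF m dvd_refl] by (simp add: k1_def)
  qed
  then have "norm (D f m k z) \<le> 0 + \<epsilon>" if "0 < \<epsilon>" for \<epsilon>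
    unfolding add_0 using that .
  then have "norm (D f m k z) \<le> 0" by (rule field_le_epsilon)
  then show ?thesis by simp
qed

text \<open>Once f vanishes on X0 it vanishes on W by density; the values on N are then sums of
  zeros, and the value at infinity is their limit.\<close>

lemma eq_0_if_at_nat:
  assumes f: "f \<in> cspace X"
    and at_nat: "\<And>k. 1 \<le> k \<Longrightarrow> f (Inr (Some k)) = (\<Sum>\<^sub>\<infinity>n\<in>P. D f n k ((h n ^^ k) (pt n)))"
  shows "f x = 0"
proof -
  have cont: "continuous_map X euclidean f" using f by (simp add: cspace_def)
  have D0: "D f n k z = 0" if "n \<in> P" "z \<in> topspace (Z n)" for n k z
    using D_eq_0[OF f at_nat that] .
  have "f (Inl (e y)) = 0" if "y \<in> topspace X0" for y
    using that
  proof (cases rule: X0_cases)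
    case (1 n j z)
    have "coord f n j z = 0"
    proof (rule antiperiodic_eq_0[where q = "\<lambda>j. coord f n j z" and p = p and n = n])
      show "coord f n (t + p n) z = - coord f n t z" for t
        by (rule coord_antiperiodic[OF 1(1)])
      show "Determinant.det (coeff_matrix p \<gamma> n) \<noteq> 0"
        using coeffs 1(1) by (auto simp: admissible_coeffs_def)
      show "(\<Sum>j<p n. \<gamma> (block_elem p n (j + 1)) * coord f n (j + i) z) = 0" for i
        using D0[OF 1(1,3), of i] by (simp add: D_def)
    qed (rule 1(2))
    then show ?thesis using norm_coord[of f n j z] 1(5) by simp
  qed
  moreover have "closedin W {w \<in> topspace W. f (Inl w) \<in> {0}}"
    using cont by (intro closedin_continuous_map_preimage[where Y = euclidean])
      (auto simp: continuous_map_space_X)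
  ultimately have "W closure_of (e ` topspace X0) \<subseteq> {w \<in> topspace W. f (Inl w) \<in> {0}}"
    by (intro closure_of_minimal) (auto simp: e_in)
  then have W0: "f (Inl w) = 0" if "w \<in> topspace W" for w
    using dense_e that by auto
  have N0: "f (Inr (Some k)) = 0" if k: "1 \<le> k" for k
  proof -
    have "(\<Sum>\<^sub>\<infinity>n\<in>P. D f n k ((h n ^^ k) (pt n))) = 0"
      using D0 funpow_h_in pt_in by (intro infsum_0) simp
    then show ?thesis using at_nat[OF k] by simp
  qed
  have inf0: "f (Inr None) = 0"
  proof (rule ccontr)
    assume "f (Inr None) \<noteq> 0"
    then have "openin euclidean (- {0 :: 'k})" "f (Inr None) \<in> - {0}"
      by (simp_all add: open_Compl)
    then have "finite {n. 1 \<le> n \<and> f (Inr (Some n)) \<notin> - {0}}"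
      using cont unfolding continuous_map_space_X by blast
    moreover have "{n. 1 \<le> n \<and> f (Inr (Some n)) \<notin> - {0}} = {1..}" using N0 by auto
    ultimately show False by (simp add: infinite_Ici)
  qed
  show ?thesis
  proof (cases "x \<in> topspace X")
    case True
    then show ?thesis
      by (cases rule: topspace_space_X_cases) (use W0 N0 inf0 in \<open>auto simp: point_one_def\<close>)
  next
    case False
    then show ?thesis using f by (simp add: cspace_def)
  qed
qed

lemma Inter_range_funpow_T: "(\<Inter>n\<in>{1..}. (T ^^ n) ` cspace X) = {\<lambda>x. 0}"
proof
  show "(\<Inter>n\<in>{1..}. (T ^^ n) ` cspace X) \<subseteq> {\<lambda>x. 0}"
  proof
    fix f assume f: "f \<in> (\<Inter>n\<in>{1..}. (T ^^ n) ` cspace X)"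
    then have "f \<in> (T ^^ 1) ` cspace X" by (rule INT_D) simp
    then have fX: "f \<in> cspace X" using T_in_cspace by auto
    have "f (Inr (Some k)) = (\<Sum>\<^sub>\<infinity>n\<in>P. D f n k ((h n ^^ k) (pt n)))" if k: "1 \<le> k" for k
    proof -
      have "f \<in> (T ^^ k) ` cspace X" using f k by blast
      then obtain g where "f = (T ^^ k) g" by blast
      then show ?thesis using funpow_T_at_nat[OF k, of g] by simp
    qed
    then show "f \<in> {\<lambda>x. 0}" using eq_0_if_at_nat[OF fX] by (simp add: fun_eq_iff)
  qed
  have "(\<lambda>x. 0) \<in> cspace X" by (simp add: cspace_def)
  moreover have "T (\<lambda>x. 0) = (\<lambda>x. 0)"
    by (simp add: fun_eq_iff shift_T_def shift_op_def delta_X_eq delta_term_def[abs_def])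
  then have "(T ^^ n) (\<lambda>x. 0) = (\<lambda>x. 0)" for n by (induction n) auto
  ultimately show "{\<lambda>x. 0} \<subseteq> (\<Inter>n\<in>{1..}. (T ^^ n) ` cspace X)"
    by (auto simp: image_iff intro!: bexI[of _ "\<lambda>x. 0"])
qed

section \<open>The type of the shift\<close>

lemma isometric_shift_T: "isometric_shift X T"
  unfolding isometric_shift_def
  using linear_isometry_T codimension_one_T Inter_range_funpow_T by blast

lemma shift_type_I_T: "shift_type_I X T"
  unfolding shift_type_I_def
proof (intro conjI isometric_shift_T bexI exI ballI)
  show "openin X {point_one}" by (rule openin_point_one)
  show "homeomorphic_map (subtopology X (topspace X - {point_one})) X (phi_X \<phi>)"
    using homeomorphic_maps_phi_X[OF homeomorphic_phi_psi] by (rule homeomorphic_maps_imp_map)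
  show "continuous_map (subtopology X (topspace X - {point_one})) euclidean (weight_X a)"
    by (intro continuous_map_from_subtopology continuous_weight_X)
qed (auto simp: norm_weight_X T_off_point_one)

text \<open>Type II would make \<Delta> a multiple of the evaluation at a single point c. One of the
  two charged points differs from c, and a test function equal to 1 there and 0 at c is not
  annihilated by \<Delta> if it also vanishes at enough of the other charged points.\<close>

lemma not_shift_type_II: "\<not> shift_type_II X T"
proof
  assume "shift_type_II X T"
  then obtain \<theta> b where \<theta>b: "\<And>f x. f \<in> cspace X \<Longrightarrow> x \<in> topspace X \<Longrightarrow> T f x = b x * f (\<theta> x)"
    unfolding shift_type_II_def by blast
  define c where "c = \<theta> point_one"
  have delta: "\<Delta> f = b point_one * f c" if "f \<in> cspace X" for f
    using \<theta>b[OF that point_one_in_space_X] by (simp add: T_point_one c_def)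
  obtain n1 m1 n2 m2 where nm: "n1 \<in> P" "m1 \<in> block p n1" "n2 \<in> P" "m2 \<in> block p n2"
    "m1 \<noteq> m2" "\<gamma> m1 \<noteq> 0" "\<gamma> m2 \<noteq> 0"
    using coeffs unfolding admissible_coeffs_def coeff_index_eq by blast
  have e_eq: "e (n, m, pt n) = e (n', m', pt n') \<longleftrightarrow> n = n' \<and> m = m'"
    if "n \<in> P" "m \<in> block p n" "n' \<in> P" "m' \<in> block p n'" for n m n' m'
    using inj_on_eq_iff[OF inj_on_e, of "(n, m, pt n)" "(n', m', pt n')"] that pt_in by auto
  have "e (n1, m1, pt n1) \<noteq> e (n2, m2, pt n2)"
    using e_eq nm by blast
  then obtain n m where n: "n \<in> P" and m: "m \<in> block p n" and nz: "\<gamma> m \<noteq> 0"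
    and c: "c \<noteq> Inl (e (n, m, pt n))"
    using nm by (metis sum.inject(1))
  let ?\<delta> = "norm (\<gamma> m)"
  \<comment> \<open>Half of the chosen coefficient, so that the blocks outside Q cannot cancel
    it.\<close>
  obtain Q0 where Q0: "finite Q0" "Q0 \<subseteq> P" "dist (sum mass Q0) (infsum mass P) \<le> ?\<delta> / 2"
    using infsum_finite_approximation[OF summable_mass, of "?\<delta> / 2"] nz by auto
  define Q where "Q = insert n Q0"
  have Q: "finite Q" "Q \<subseteq> P" "n \<in> Q" using Q0 n by (auto simp: Q_def)
  have "sum mass Q0 \<le> sum mass Q"
    using Q0 by (intro sum_mono2) (auto simp: Q_def mass_def intro: sum_nonneg)
  then have tail: "infsum mass P - sum mass Q \<le> ?\<delta> / 2"
    using Q0(3) unfolding dist_real_def abs_le_iff by linarith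
  \<comment> \<open>The points where the test function is forced to vanish: c, if it lies in W, and
    the other base points over the blocks in Q. If c is not in W, the function vanishes there by its
    definition.\<close>
  define C where "C = topspace W \<inter> {w. c = Inl w} \<union>
    (\<lambda>(n', m'). e (n', m', pt n')) ` (Sigma Q (block p) - {(n, m)})"
  have "finite C"
  proof -
    have "{w. c = Inl w} \<subseteq> {projl c}" by auto
    then have "finite {w. c = Inl w}" by (rule finite_subset) simp
    then show ?thesis using Q(1) by (simp add: C_def)
  qed
  moreover have "C \<subseteq> topspace W"
    using Q(2) pt_in e_in by (auto simp: C_def)
  ultimately have "closedin W C"
    using Hausdorff_imp_t1_space[OF Hausdorff_W] by (simp add: t1_space_closedin_finite)
  moreover have "e (n, m, pt n) \<in> topspace W - C"
  proof -
    have "e (n, m, pt n) \<noteq> e (n', m', pt n')" if "n' \<in> Q" "m' \<in> block p n'" "(n', m') \<noteq> (n, m)" for n' m'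
      using e_eq[OF n m, of n' m'] that Q(2) by auto
    then show ?thesis using c n m pt_in e_in by (auto simp: C_def)
  qed
  moreover have "completely_regular_space W"
    using compact_W Hausdorff_W
    by (simp add: normal_imp_completely_regular_space compact_Hausdorff_or_regular_imp_normal_space)
  ultimately obtain g where g: "continuous_map W (top_of_set {0..1::real}) g"
    "g (e (n, m, pt n)) = 0" "g ` C \<subseteq> {1}"
    unfolding completely_regular_space_def by blast
  then have g_cont: "continuous_map W euclidean g" and g_range: "w \<in> topspace W \<Longrightarrow> g w \<in> {0..1}" for w
    by (auto simp: continuous_map_in_subtopology)
  \<comment> \<open>The separating function is 0 at the chosen point and 1 on C, hence the use of 1
    - g.\<close>
  define f :: "'w + nat option \<Rightarrow> 'k" where
    "f x = (case x of Inl w \<Rightarrow> if w \<in> topspace W then of_real (1 - g w) else 0 | Inr y \<Rightarrow> 0)" for x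
  have "continuous_map W euclideanreal (\<lambda>w. 1 - g w)"
    by (intro continuous_map_diff g_cont) simp
  moreover have "continuous_map euclideanreal euclidean (of_real :: real \<Rightarrow> 'k)"
    using continuous_on_of_real[OF continuous_on_id] by simp
  ultimately have "continuous_map W euclidean (of_real \<circ> (\<lambda>w. 1 - g w) :: 'w \<Rightarrow> 'k)"
    by (rule continuous_map_compose)
  then have "continuous_map W euclidean (\<lambda>w. f (Inl w))"
    by (rule continuous_map_eq) (simp add: f_def)
  then have "continuous_map X euclidean f"
    unfolding continuous_map_space_X by (simp add: f_def)
  then have fX: "f \<in> cspace X" by (auto simp: cspace_def f_def split: sum.splits)
  have f1: "norm (f x) \<le> 1" for x
  proof (cases x)
    case (Inl w)
    show ?thesis
    proof (cases "w \<in> topspace W")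
      case True
      then have "f x = of_real (1 - g w)" by (simp add: f_def Inl)
      then show ?thesis using g_range[OF True] by (simp only: norm_of_real) simp
    qed (simp add: f_def Inl)
  qed (simp add: f_def)
  have f0: "f (Inl (e (n', m', pt n'))) = 0" if "n' \<in> Q" "m' \<in> block p n'" "(n', m') \<noteq> (n, m)" for n' m'
  proof -
    have "e (n', m', pt n') \<in> C" using that by (auto simp: C_def)
    then show ?thesis using g(3) by (auto simp: f_def)
  qed
  have "f c = 0"
  proof (cases c)
    case (Inl w)
    then have "w \<in> topspace W \<Longrightarrow> w \<in> C" by (simp add: C_def)
    then show ?thesis using Inl g(3) by (auto simp: f_def)
  qed (simp add: f_def)
  then have "\<Delta> f = 0" using delta[OF fX] by simp
  have "delta_term f n' = 0" if "n' \<in> Q - {n}" for n'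
    unfolding delta_term_def using that f0 by (intro sum.neutral) auto
  then have "sum (delta_term f) Q = delta_term f n"
    using Q by (simp add: sum.remove)
  also have "\<dots> = \<gamma> m * f (Inl (e (n, m, pt n))) + (\<Sum>m'\<in>block p n - {m}. \<gamma> m' * f (Inl (e (n, m', pt n))))"
    unfolding delta_term_def using m by (intro sum.remove) auto
  also have "f (Inl (e (n, m, pt n))) = 1"
    using n m pt_in e_in g(2) by (simp add: f_def)
  also have "(\<Sum>m'\<in>block p n - {m}. \<gamma> m' * f (Inl (e (n, m', pt n)))) = 0"
    using f0 Q(3) by (intro sum.neutral) auto
  finally have "sum (delta_term f) Q = \<gamma> m" by simp
  moreover have "norm (infsum (delta_term f) P - sum (delta_term f) Q) \<le> infsum mass P - sum mass Q"
    using norm_delta_term[of f 1] f1 Q by (intro dominated_infsum(2) summable_mass) auto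
  ultimately have "?\<delta> \<le> infsum mass P - sum mass Q"
    using \<open>\<Delta> f = 0\<close> by (simp add: delta_X_eq)
  then have "?\<delta> \<le> ?\<delta> / 2" using tail by (rule order_trans)
  then show False using nz by simp
qed

lemma shift_type_I0_T: "shift_type_I0 X T"
  unfolding shift_type_I0_def using shift_type_I_T not_shift_type_II by blast

end

theorem theorem8p4:
  fixes P :: "nat set" and p :: "nat \<Rightarrow> nat"
    and Z :: "nat \<Rightarrow> 'z topology" and h :: "nat \<Rightarrow> 'z \<Rightarrow> 'z" and pt :: "nat \<Rightarrow> 'z"
    and W :: "'w topology" and e :: "nat \<times> nat \<times> 'z \<Rightarrow> 'w" and \<phi> :: "'w \<Rightarrow> 'w"
  assumes "initial_index_set P"
    and "compatible_sequence P p"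
    and "basic_family P Z h pt"
    and "transitive_family {2 * p n | n. n \<in> P} P Z h pt"
    and "compactification (space_X0 P p Z) W e"
    and "phi_extension P p Z h W e \<phi>"
  shows "(\<forall>(a :: 'w \<Rightarrow> real) (\<gamma> :: nat \<Rightarrow> real).
            weight_extension P p Z W e a \<and> admissible_coeffs P p \<gamma> \<longrightarrow>
              shift_type_I0 (space_X W) (shift_T P p pt W e \<phi> a \<gamma>) \<and>
              (P = {1..} \<longrightarrow>
                 infinitely_generated (space_X W) point_one nat_points (phi_X \<phi>)) \<and>
              (\<forall>N. P = {1..N} \<longrightarrow>
                 n_generated (space_X W) point_one nat_points (phi_X \<phi>) N)) \<and>
         (\<forall>(a :: 'w \<Rightarrow> complex) (\<gamma> :: nat \<Rightarrow> complex).
            weight_extension P p Z W e a \<and> admissible_coeffs P p \<gamma> \<longrightarrow>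
              shift_type_I0 (space_X W) (shift_T P p pt W e \<phi> a \<gamma>) \<and>
              (P = {1..} \<longrightarrow>
                 infinitely_generated (space_X W) point_one nat_points (phi_X \<phi>)) \<and>
              (\<forall>N. P = {1..N} \<longrightarrow>
                 n_generated (space_X W) point_one nat_points (phi_X \<phi>) N))"
proof -
  have space: "shift_space P p Z h pt W e \<phi>"
    by unfold_locales (fact assms)+
  have real: "shift_type_I0 (space_X W) (shift_T P p pt W e \<phi> a \<gamma>)"
    if "weight_extension P p Z W e a" "admissible_coeffs P p \<gamma>" for a :: "'w \<Rightarrow> real" and \<gamma>
  proof -
    have "weighted_shift_space P p Z h pt W e \<phi> a \<gamma>"
      by (intro weighted_shift_space.intro space weighted_shift_space_axioms.intro that)
    then show ?thesis by (rule weighted_shift_space.shift_type_I0_T)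
  qed
  have complex: "shift_type_I0 (space_X W) (shift_T P p pt W e \<phi> a \<gamma>)"
    if "weight_extension P p Z W e a" "admissible_coeffs P p \<gamma>" for a :: "'w \<Rightarrow> complex" and \<gamma>
  proof -
    have "weighted_shift_space P p Z h pt W e \<phi> a \<gamma>"
      by (intro weighted_shift_space.intro space weighted_shift_space_axioms.intro that)
    then show ?thesis by (rule weighted_shift_space.shift_type_I0_T)
  qed
  show ?thesis
    using real complex shift_space.infinitely_generated_if[OF space] shift_space.n_generated_N[OF space]
    by blast
qed

end
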